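(* Let $K$ be an arbitrary field, $R$ a $K$-algebra, and $J$ an ideal of $R$. If $J$ and $R/J$ are both locally matricial $K$-algebras, then $R$ is a locally matricial $K$-algebra.
   Context: All algebras are associative but not necessarily unital $K$-algebras; ideals are two-sided ring ideals that are also $K$-subspaces. A $K$-algebra is matricial if it is isomorphic to $\prod_{i=1}^k M_{n_i}(K)$ for some positive integers $n_1,\dots,n_k$. A $K$-algebra $R$ is locally matricial if every finite subset of $R$ is contained in a matricial subalgebra of $R$. *)

theory Defs
  imports Main
begin

record ('k, 'a) kalg =
  acarrier :: "'a set"
  azero :: 'a
  aadd :: "'a \<Rightarrow> 'a \<Rightarrow> 'a"
  amul :: "'a \<Rightarrow> 'a \<Rightarrow> 'a"
  asmul :: "'k \<Rightarrow> 'a \<Rightarrow> 'a"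

definition kalgebra :: "('k::field, 'a) kalg \<Rightarrow> bool" where
  "kalgebra A \<longleftrightarrow>
     azero A \<in> acarrier A \<and>
     (\<forall>x\<in>acarrier A. \<forall>y\<in>acarrier A. aadd A x y \<in> acarrier A) \<and>
     (\<forall>x\<in>acarrier A. \<forall>y\<in>acarrier A. amul A x y \<in> acarrier A) \<and>
     (\<forall>a. \<forall>x\<in>acarrier A. asmul A a x \<in> acarrier A) \<and>
     (\<forall>x\<in>acarrier A. \<forall>y\<in>acarrier A. \<forall>z\<in>acarrier A.
        aadd A (aadd A x y) z = aadd A x (aadd A y z)) \<and>
     (\<forall>x\<in>acarrier A. \<forall>y\<in>acarrier A. aadd A x y = aadd A y x) \<and>
     (\<forall>x\<in>acarrier A. aadd A (azero A) x = x) \<and>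
     (\<forall>x\<in>acarrier A. \<exists>y\<in>acarrier A. aadd A x y = azero A) \<and>
     (\<forall>x\<in>acarrier A. \<forall>y\<in>acarrier A. \<forall>z\<in>acarrier A.
        amul A (amul A x y) z = amul A x (amul A y z)) \<and>
     (\<forall>x\<in>acarrier A. \<forall>y\<in>acarrier A. \<forall>z\<in>acarrier A.
        amul A x (aadd A y z) = aadd A (amul A x y) (amul A x z)) \<and>
     (\<forall>x\<in>acarrier A. \<forall>y\<in>acarrier A. \<forall>z\<in>acarrier A.
        amul A (aadd A x y) z = aadd A (amul A x z) (amul A y z)) \<and>
     (\<forall>a. \<forall>x\<in>acarrier A. \<forall>y\<in>acarrier A.
        asmul A a (aadd A x y) = aadd A (asmul A a x) (asmul A a y)) \<and>
     (\<forall>a b. \<forall>x\<in>acarrier A. asmul A (a + b) x = aadd A (asmul A a x) (asmul A b x)) \<and>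
     (\<forall>a b. \<forall>x\<in>acarrier A. asmul A (a * b) x = asmul A a (asmul A b x)) \<and>
     (\<forall>x\<in>acarrier A. asmul A 1 x = x) \<and>
     (\<forall>a. \<forall>x\<in>acarrier A. \<forall>y\<in>acarrier A.
        asmul A a (amul A x y) = amul A (asmul A a x) y \<and>
        asmul A a (amul A x y) = amul A x (asmul A a y))"

definition subalgebra :: "'a set \<Rightarrow> ('k::field, 'a) kalg \<Rightarrow> bool" where
  "subalgebra S A \<longleftrightarrow> S \<subseteq> acarrier A \<and> azero A \<in> S \<and>
     (\<forall>x\<in>S. \<forall>y\<in>S. aadd A x y \<in> S) \<and>
     (\<forall>x\<in>S. \<forall>y\<in>S. amul A x y \<in> S) \<and>
     (\<forall>a. \<forall>x\<in>S. asmul A a x \<in> S)"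

definition kideal :: "'a set \<Rightarrow> ('k::field, 'a) kalg \<Rightarrow> bool" where
  "kideal J A \<longleftrightarrow> J \<subseteq> acarrier A \<and> azero A \<in> J \<and>
     (\<forall>x\<in>J. \<forall>y\<in>J. aadd A x y \<in> J) \<and>
     (\<forall>a. \<forall>x\<in>J. asmul A a x \<in> J) \<and>
     (\<forall>r\<in>acarrier A. \<forall>x\<in>J. amul A r x \<in> J \<and> amul A x r \<in> J)"

definition restrict_alg :: "('k, 'a) kalg \<Rightarrow> 'a set \<Rightarrow> ('k, 'a) kalg" where
  "restrict_alg A S = A\<lparr>acarrier := S\<rparr>"

definition coset :: "('k, 'a) kalg \<Rightarrow> 'a set \<Rightarrow> 'a \<Rightarrow> 'a set" where
  "coset A J x = {aadd A x j | j. j \<in> J}"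

definition rep :: "'a set \<Rightarrow> 'a" where
  "rep C = (SOME x. x \<in> C)"

definition quot_alg :: "('k, 'a) kalg \<Rightarrow> 'a set \<Rightarrow> ('k, 'a set) kalg" where
  "quot_alg A J =
     \<lparr> acarrier = coset A J ` acarrier A,
       azero = coset A J (azero A),
       aadd = (\<lambda>C D. coset A J (aadd A (rep C) (rep D))),
       amul = (\<lambda>C D. coset A J (amul A (rep C) (rep D))),
       asmul = (\<lambda>a C. coset A J (asmul A a (rep C))) \<rparr>"

text \<open>The matricial algebra M_{n_1}(K) x ... x M_{n_k}(K), ns = [n_1,...,n_k].
  An element is a function (i, r, c) \<mapsto> entry (r,c) of the i-th component
  (0-indexed), vanishing outside the index ranges.\<close>

definition mat_carrier :: "nat list \<Rightarrow> (nat \<Rightarrow> nat \<Rightarrow> nat \<Rightarrow> 'k::field) set" where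
  "mat_carrier ns = {f. \<forall>i r c. (i \<ge> length ns \<or> r \<ge> ns ! i \<or> c \<ge> ns ! i) \<longrightarrow> f i r c = 0}"

definition matricial_alg :: "nat list \<Rightarrow> ('k::field, nat \<Rightarrow> nat \<Rightarrow> nat \<Rightarrow> 'k) kalg" where
  "matricial_alg ns =
     \<lparr> acarrier = mat_carrier ns,
       azero = (\<lambda>i r c. 0),
       aadd = (\<lambda>f g i r c. f i r c + g i r c),
       amul = (\<lambda>f g i r c. if i < length ns then (\<Sum>j<ns ! i. f i r j * g i j c) else 0),
       asmul = (\<lambda>a f i r c. a * f i r c) \<rparr>"

definition kalg_iso :: "('k, 'a) kalg \<Rightarrow> ('k, 'b) kalg \<Rightarrow> ('a \<Rightarrow> 'b) \<Rightarrow> bool" where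
  "kalg_iso A B \<phi> \<longleftrightarrow> bij_betw \<phi> (acarrier A) (acarrier B) \<and>
     (\<forall>x\<in>acarrier A. \<forall>y\<in>acarrier A. \<phi> (aadd A x y) = aadd B (\<phi> x) (\<phi> y)) \<and>
     (\<forall>x\<in>acarrier A. \<forall>y\<in>acarrier A. \<phi> (amul A x y) = amul B (\<phi> x) (\<phi> y)) \<and>
     (\<forall>a. \<forall>x\<in>acarrier A. \<phi> (asmul A a x) = asmul B a (\<phi> x))"

definition matricial :: "('k::field, 'a) kalg \<Rightarrow> bool" where
  "matricial A \<longleftrightarrow> (\<exists>ns \<phi>. (\<forall>n\<in>set ns. n > 0) \<and> kalg_iso (matricial_alg ns) A \<phi>)"

definition locally_matricial :: "('k::field, 'a) kalg \<Rightarrow> bool" where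
  "locally_matricial A \<longleftrightarrow>
     (\<forall>F. finite F \<and> F \<subseteq> acarrier A \<longrightarrow>
        (\<exists>S. subalgebra S A \<and> F \<subseteq> S \<and> matricial (restrict_alg A S)))"

end

theory Submission
  imports Defs "HOL.Vector_Spaces"
begin

text \<open>A locally matricial ideal J is von Neumann regular, and every finite subset of a regular
  ring has a two-sided idempotent unit. Regularity lets one lift orthogonal idempotents from R/J to
  R. Let e_i be a lift of one diagonal matrix unit of the i-th block, and a_ir, b_ir lifts of the
  units in its row and column. If h_i is an idempotent of e_i J e_i that is a unit for the finitely
  many defects of these lifts, then with p_i = e_i - h_i the elements b_ir p_i a_is are honest matrix
  units. Enlarging h_i, one also gets every given f in R into the form g + j with g in their span
  and j in J annihilated by them on both sides. The elements j have a common idempotent unit q in J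
  that is orthogonal to the matrix units, and they lie in a corner q T q of a matricial subalgebra T
  of J. Gaussian elimination shows that such a corner is again matricial; the two orthogonal systems
  of matrix units together span the required subalgebra.\<close>

section \<open>Regular rings and local units\<close>

text \<open>Lifted diagonal idempotents of one block need not be equivalent in \<open>R\<close>:
  lifted row and column units multiply to them only modulo \<open>J\<close>, and two lifts may
  differ by an idempotent of \<open>J\<close>. In general no choice of off-diagonal elements repairs
  a fixed lifted diagonal, so the diagonal itself has to be shrunk. Cutting with idempotents of
  \<open>J\<close> leaves the classes modulo \<open>J\<close> unchanged, and whatever is cut off is
  absorbed by the part of the subalgebra that lies in \<open>J\<close>. The other constraint is that
  nothing is unital. Factors such as 1 - u occur only in expanded form, and units are local:
  idempotents that act as identity on a finite set. All algebras are moved into one ring type, where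
  ring identities and \<open>span\<close> are available; there a matricial subalgebra becomes the
  span of a finite system of matrix units, and the quotient is replaced by representatives and
  congruences.\<close>

definition regular_ring :: "'b::ring set \<Rightarrow> bool" where
  "regular_ring C \<longleftrightarrow> 0 \<in> C \<and> (\<forall>x\<in>C. \<forall>y\<in>C. x + y \<in> C \<and> x - y \<in> C \<and> x * y \<in> C) \<and>
     (\<forall>x\<in>C. \<exists>z\<in>C. x * z * x = x)"

lemma regular_ringD:
  assumes "regular_ring C"
  shows "0 \<in> C" "x \<in> C \<Longrightarrow> y \<in> C \<Longrightarrow> x + y \<in> C" "x \<in> C \<Longrightarrow> y \<in> C \<Longrightarrow> x - y \<in> C"
    "x \<in> C \<Longrightarrow> y \<in> C \<Longrightarrow> x * y \<in> C" "x \<in> C \<Longrightarrow> \<exists>z\<in>C. x * z * x = x"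
  using assms by (auto simp: regular_ring_def)

text \<open>Induction on \<open>X\<close>: the part \<open>y' = y - f * y\<close> that the current
  unit misses generates a right ideal with an idempotent generator, and this generator can be made
  orthogonal to \<open>f\<close>, so that the sum is again idempotent.\<close>

lemma regular_ring_left_unit:
  assumes C: "regular_ring C" and "finite X" "X \<subseteq> C"
  shows "\<exists>f\<in>C. f * f = f \<and> (\<forall>x\<in>X. f * x = x)"
  using assms(2,3)
proof (induction X rule: finite_induct)
  case empty
  then show ?case using regular_ringD(1)[OF C] by force
next
  case (insert y X)
  then obtain f where f: "f \<in> C" "f * f = f" "\<And>x. x \<in> X \<Longrightarrow> f * x = x" by auto
  define y' where "y' = y - f * y"
  have yC: "y \<in> C" and y'C: "y' \<in> C"
    using insert f C by (auto simp: y'_def regular_ringD)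
  then obtain z where z: "z \<in> C" "y' * z * y' = y'" using regular_ringD(5)[OF C] by blast
  \<comment> \<open>\<open>y' * z\<close> is an idempotent fixing \<open>y'\<close> from the left.
    Subtracting \<open>y' * z * f\<close> makes it annihilate \<open>f\<close> on the right as well;
    on the left \<open>f * y' = 0\<close> already suffices.\<close>
  define g where "g = y' * z - y' * z * f"
  have gC: "g \<in> C" using y'C z f C by (simp add: g_def regular_ringD)
  have ff: "f * (f * t) = f * t" for t using f(2) by (simp add: mult.assoc[symmetric])
  have fy': "f * y' = 0" by (simp add: y'_def algebra_simps ff)
  have fg: "f * g = 0" by (simp add: g_def right_diff_distrib mult.assoc[symmetric] fy')
  have gf: "g * f = 0" by (simp add: g_def left_diff_distrib mult.assoc f(2))
  have gy: "g * y = y'"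
  proof -
    have "g * y = y' * z * y'" by (simp add: g_def y'_def algebra_simps)
    then show ?thesis using z by simp
  qed
  have gy': "g * y' = y'" by (simp add: y'_def right_diff_distrib gy mult.assoc[symmetric] gf)
  have gg: "g * g = g"
  proof -
    have "g * g = (g * y') * z - (g * y') * z * f" by (simp add: g_def algebra_simps)
    also have "\<dots> = g" unfolding gy' by (simp add: g_def)
    finally show ?thesis .
  qed
  have gx: "g * x = 0" if "x \<in> X" for x
  proof -
    have "g * x = g * (f * x)" using f(3) that by simp
    then show ?thesis by (simp add: mult.assoc[symmetric] gf)
  qed
  show ?case
  proof (intro bexI[of _ "f + g"] conjI ballI)
    show "(f + g) * (f + g) = f + g" by (simp add: algebra_simps f fg gf gg)
    show "(f + g) * x = x" if "x \<in> insert y X" for x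
      using that f(3) gx by (auto simp: distrib_right gy y'_def)
    show "f + g \<in> C" using f gC C by (simp add: regular_ringD)
  qed
qed

lemma regular_ring_right_unit:
  assumes C: "regular_ring C" and "finite X" "X \<subseteq> C"
  shows "\<exists>f\<in>C. f * f = f \<and> (\<forall>x\<in>X. x * f = x)"
  using assms(2,3)
proof (induction X rule: finite_induct)
  case empty
  then show ?case using regular_ringD(1)[OF C] by force
next
  case (insert y X)
  then obtain f where f: "f \<in> C" "f * f = f" "\<And>x. x \<in> X \<Longrightarrow> x * f = x" by auto
  define y' where "y' = y - y * f"
  have yC: "y \<in> C" and y'C: "y' \<in> C"
    using insert f C by (auto simp: y'_def regular_ringD)
  then obtain z where z: "z \<in> C" "y' * z * y' = y'" using regular_ringD(5)[OF C] by blast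
  define g where "g = z * y' - f * z * y'"
  have gC: "g \<in> C" using y'C z f C by (simp add: g_def regular_ringD)
  have ff: "f * (f * t) = f * t" for t using f(2) by (simp add: mult.assoc[symmetric])
  have y'f: "y' * f = 0" by (simp add: y'_def algebra_simps f(2))
  have gf: "g * f = 0" by (simp add: g_def left_diff_distrib mult.assoc y'f)
  have fg: "f * g = 0" by (simp add: g_def right_diff_distrib mult.assoc ff)
  have yg: "y * g = y'"
  proof -
    have "y * g = y' * z * y'" by (simp add: g_def y'_def algebra_simps)
    then show ?thesis using z by simp
  qed
  have y'g: "y' * g = y'" by (simp add: y'_def left_diff_distrib yg mult.assoc fg)
  have gg: "g * g = g"
  proof -
    have "g * g = z * (y' * g) - f * z * (y' * g)" by (simp add: g_def algebra_simps)
    also have "\<dots> = g" unfolding y'g by (simp add: g_def)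
    finally show ?thesis .
  qed
  have xg: "x * g = 0" if "x \<in> X" for x
  proof -
    have "x * g = (x * f) * g" using f(3) that by simp
    then show ?thesis by (simp add: mult.assoc fg)
  qed
  show ?case
  proof (intro bexI[of _ "f + g"] conjI ballI)
    show "(f + g) * (f + g) = f + g" by (simp add: algebra_simps f fg gf gg)
    show "x * (f + g) = x" if "x \<in> insert y X" for x
      using that f(3) xg by (auto simp: distrib_left yg y'_def)
    show "f + g \<in> C" using f gC C by (simp add: regular_ringD)
  qed
qed

text \<open>The right unit \<open>g\<close> is chosen for \<open>f\<close> as well as for
  \<open>X\<close>. The combination \<open>f + g - g * f\<close> is 1 - (1 - g)(1 - f) in expanded
  form, and \<open>f * g = f\<close> turns (1 - f)(1 - g) into 1 - g, which gives
  idempotence.\<close>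

lemma regular_ring_local_unit:
  assumes C: "regular_ring C" and "finite X" "X \<subseteq> C"
  shows "\<exists>h\<in>C. h * h = h \<and> (\<forall>x\<in>X. h * x = x \<and> x * h = x)"
proof -
  obtain f where f: "f \<in> C" "f * f = f" "\<And>x. x \<in> X \<Longrightarrow> f * x = x"
    using regular_ring_left_unit[OF assms] by blast
  obtain g where g: "g \<in> C" "g * g = g" "f * g = f" "\<And>x. x \<in> X \<Longrightarrow> x * g = x"
    using regular_ring_right_unit[OF C, of "insert f X"] assms f by auto
  have ff: "f * (f * t) = f * t" and gg: "g * (g * t) = g * t" and fg: "f * (g * t) = f * t" for t
    using f(2) g(2,3) by (simp_all add: mult.assoc[symmetric])
  show ?thesis
  proof (intro bexI[of _ "f + g - g * f"] conjI ballI)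
    show "(f + g - g * f) * (f + g - g * f) = f + g - g * f"
      by (simp add: algebra_simps f(2) g(2,3) ff gg fg)
    fix x assume x: "x \<in> X"
    have xg: "x * (g * t) = x * t" for t using g(4)[OF x] by (simp add: mult.assoc[symmetric])
    show "(f + g - g * f) * x = x" using f(3)[OF x] by (simp add: algebra_simps)
    show "x * (f + g - g * f) = x" using g(4)[OF x] by (simp add: algebra_simps xg)
  next
    show "f + g - g * f \<in> C" using f g C by (simp add: regular_ringD)
  qed
qed

section \<open>Lifting modulo a regular ideal\<close>

locale regular_ideal =
  fixes R J :: "'b::ring set"
  assumes R_closed: "0 \<in> R" "x \<in> R \<Longrightarrow> y \<in> R \<Longrightarrow> x + y \<in> R"
      "x \<in> R \<Longrightarrow> y \<in> R \<Longrightarrow> x - y \<in> R" "x \<in> R \<Longrightarrow> y \<in> R \<Longrightarrow> x * y \<in> R"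
    and J_subset: "J \<subseteq> R"
    and J_left: "x \<in> R \<Longrightarrow> y \<in> J \<Longrightarrow> x * y \<in> J"
    and J_right: "x \<in> J \<Longrightarrow> y \<in> R \<Longrightarrow> x * y \<in> J"
    and J_regular: "regular_ring J"
begin

lemmas J_closed = regular_ringD(1-4)[OF J_regular]

lemma J_in_R: "x \<in> J \<Longrightarrow> x \<in> R" using J_subset by blast

section \<open>Congruence modulo the ideal\<close>

definition cong :: "'b \<Rightarrow> 'b \<Rightarrow> bool" (infix "\<approx>" 50) where "x \<approx> y \<longleftrightarrow> x - y \<in> J"

lemma cong_refl [simp]: "x \<approx> x" by (simp add: cong_def J_closed)

lemma cong_sym: "x \<approx> y \<Longrightarrow> y \<approx> x"
  using J_closed(3)[OF J_closed(1), of "x - y"] by (simp add: cong_def)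

lemma cong_trans [trans]: "x \<approx> y \<Longrightarrow> y \<approx> z \<Longrightarrow> x \<approx> z"
  using J_closed(2)[of "x - y" "y - z"] by (simp add: cong_def)

lemma cong_diff: "x \<approx> x' \<Longrightarrow> y \<approx> y' \<Longrightarrow> x - y \<approx> x' - y'"
  using J_closed(3)[of "x - x'" "y - y'"] by (simp add: cong_def algebra_simps)

lemma cong_add: "x \<approx> x' \<Longrightarrow> y \<approx> y' \<Longrightarrow> x + y \<approx> x' + y'"
  using J_closed(2)[of "x - x'" "y - y'"] by (simp add: cong_def algebra_simps)

text \<open>The asymmetric side conditions come from the splitting of \<open>x * y - x' * y'\<close>
  into \<open>(x - x') * y + x' * (y - y')\<close>: the elements multiplied into \<open>J\<close>
  are \<open>y\<close> and \<open>x'\<close>.\<close>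

lemma cong_mult:
  assumes "x \<approx> x'" "y \<approx> y'" "x' \<in> R" "y \<in> R"
  shows "x * y \<approx> x' * y'"
proof -
  have "(x - x') * y + x' * (y - y') \<in> J"
    using assms J_closed(2)[OF J_right J_left] by (simp add: cong_def)
  then show ?thesis by (simp add: cong_def algebra_simps)
qed

lemma cong_mult2:
  assumes "x \<approx> x'" "y \<approx> y'" "x' \<in> R" "y \<in> R" "x' * y' \<approx> z"
  shows "x * y \<approx> z"
  using cong_mult assms cong_trans by blast

lemma cong_0: "x \<approx> 0 \<longleftrightarrow> x \<in> J" by (simp add: cong_def)

lemma cong_0_sum: "(\<And>i. i \<in> A \<Longrightarrow> x i \<approx> 0) \<Longrightarrow> sum x A \<approx> 0"
  by (induction A rule: infinite_finite_induct) (auto simp: cong_0 J_closed)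

lemma R_sum: "(\<And>i. i \<in> A \<Longrightarrow> x i \<in> R) \<Longrightarrow> sum x A \<in> R"
  by (induction A rule: infinite_finite_induct) (auto simp: R_closed)

section \<open>Regularity and local units in corners and annihilators of the ideal\<close>

lemma regular_corner:
  assumes e: "e \<in> R" "e * e = e"
  shows "regular_ring {x \<in> J. e * x = x \<and> x * e = x}"
  unfolding regular_ring_def
proof (intro conjI ballI)
  fix x assume x: "x \<in> {x \<in> J. e * x = x \<and> x * e = x}"
  then obtain z where z: "z \<in> J" "x * z * x = x" using regular_ringD(5)[OF J_regular] by blast
  have "x * (e * z * e) * x = (x * e) * z * (e * x)" by (simp add: mult.assoc)
  then have "x * (e * z * e) * x = x" using x z by simp
  moreover have "e * z * e \<in> J" using z e by (simp add: J_left J_right)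
  moreover have "e * (e * z * e) = e * z * e" "e * z * e * e = e * z * e"
    using e by (simp_all add: mult.assoc[symmetric]) (simp add: mult.assoc)
  ultimately show "\<exists>z\<in>{x \<in> J. e * x = x \<and> x * e = x}. x * z * x = x" by blast
next
  fix x y assume xy: "x \<in> {x \<in> J. e * x = x \<and> x * e = x}" "y \<in> {x \<in> J. e * x = x \<and> x * e = x}"
  then show "x + y \<in> {x \<in> J. e * x = x \<and> x * e = x}" "x - y \<in> {x \<in> J. e * x = x \<and> x * e = x}"
    by (auto simp: J_closed algebra_simps)
  have "e * (x * y) = x * y" "x * y * e = x * y"
    using xy by (simp_all add: mult.assoc[symmetric]) (simp add: mult.assoc)
  then show "x * y \<in> {x \<in> J. e * x = x \<and> x * e = x}" using xy by (simp add: J_closed)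
qed (simp add: J_closed)

lemma regular_annihilator:
  assumes u: "u \<in> R" "u * u = u"
  shows "regular_ring {x \<in> J. u * x = 0 \<and> x * u = 0}"
  unfolding regular_ring_def
proof (intro conjI ballI)
  fix x assume x: "x \<in> {x \<in> J. u * x = 0 \<and> x * u = 0}"
  then obtain z where z: "z \<in> J" "x * z * x = x" using regular_ringD(5)[OF J_regular] by blast
  \<comment> \<open>\<open>w\<close> is (1 - u) z (1 - u) in expanded form. It is still a
    quasi-inverse of \<open>x\<close>, because \<open>x\<close> is annihilated by \<open>u\<close>
    on both sides.\<close>
  define w where "w = z - u * z - z * u + u * z * u"
  have uu: "u * (u * t) = u * t" for t using u by (simp add: mult.assoc[symmetric])
  have xu: "x * (u * t) = 0" for t using x by (simp add: mult.assoc[symmetric])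
  have ux: "u * x = 0" using x by simp
  have "x * w * x = x * (z * x)"
    by (simp add: w_def algebra_simps xu ux)
  moreover have "w \<in> J" using z u by (simp add: w_def J_left J_right J_closed)
  moreover have "u * w = 0" "w * u = 0"
    using u by (simp_all add: w_def algebra_simps uu)
  ultimately show "\<exists>z\<in>{x \<in> J. u * x = 0 \<and> x * u = 0}. x * z * x = x"
    using z by (intro bexI[of _ w]) (auto simp: mult.assoc)
next
  fix x y assume xy: "x \<in> {x \<in> J. u * x = 0 \<and> x * u = 0}" "y \<in> {x \<in> J. u * x = 0 \<and> x * u = 0}"
  then show "x + y \<in> {x \<in> J. u * x = 0 \<and> x * u = 0}" "x - y \<in> {x \<in> J. u * x = 0 \<and> x * u = 0}"
    by (auto simp: J_closed algebra_simps)
  have "u * (x * y) = 0" "x * y * u = 0"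
    using xy by (simp_all add: mult.assoc[symmetric]) (simp add: mult.assoc)
  then show "x * y \<in> {x \<in> J. u * x = 0 \<and> x * u = 0}" using xy by (simp add: J_closed)
qed (simp add: J_closed)

text \<open>An element with \<open>e * x = x\<close> need not lie in the corner of \<open>e\<close>,
  but with a quasi-inverse z of \<open>x\<close> the product x z e does. A left unit of this
  surrogate is a left unit of \<open>x\<close>, since (x z e) x = x z x = x. The elements of
  \<open>Y\<close> are treated dually, and one unit \<open>h\<close> of the corner serves all
  surrogates.\<close>

lemma corner_local_unit:
  assumes e: "e \<in> R" "e * e = e"
    and X: "finite X" "X \<subseteq> J" "\<And>x. x \<in> X \<Longrightarrow> e * x = x"
    and Y: "finite Y" "Y \<subseteq> J" "\<And>y. y \<in> Y \<Longrightarrow> y * e = y"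
  shows "\<exists>h\<in>J. h * h = h \<and> e * h = h \<and> h * e = h \<and> (\<forall>x\<in>X. h * x = x) \<and> (\<forall>y\<in>Y. y * h = y)"
proof -
  have "\<forall>x\<in>J. \<exists>z\<in>J. x * z * x = x" using regular_ringD(5)[OF J_regular] by blast
  then obtain z where z: "\<And>x. x \<in> J \<Longrightarrow> z x \<in> J" "\<And>x. x \<in> J \<Longrightarrow> x * z x * x = x"
    by metis
  let ?C = "{x \<in> J. e * x = x \<and> x * e = x}"
  define G where "G = (\<lambda>x. x * z x * e) ` X \<union> (\<lambda>y. e * z y * y) ` Y"
  have ee: "e * (e * t) = e * t" for t using e by (simp add: mult.assoc[symmetric])
  have "x * z x * e \<in> ?C" if "x \<in> X" for x
  proof -
    have "x \<in> J" "e * x = x" using that X by auto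
    then show ?thesis using z e by (simp add: J_left J_right J_closed mult.assoc)
        (simp add: mult.assoc[symmetric])
  qed
  moreover have "e * z y * y \<in> ?C" if "y \<in> Y" for y
  proof -
    have "y \<in> J" "y * e = y" using that Y by auto
    then show ?thesis using z e by (simp add: J_left J_right J_closed mult.assoc ee)
  qed
  ultimately have "G \<subseteq> ?C" by (auto simp: G_def)
  moreover have "finite G" using X Y by (simp add: G_def)
  ultimately have "\<exists>h\<in>?C. h * h = h \<and> (\<forall>g\<in>G. h * g = g \<and> g * h = g)"
    by (intro regular_ring_local_unit regular_corner e)
  then obtain h where h: "h \<in> ?C" "h * h = h" "\<And>g. g \<in> G \<Longrightarrow> h * g = g \<and> g * h = g"
    by auto
  show ?thesis
  proof (intro bexI[of _ h] conjI ballI)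
    fix x assume x: "x \<in> X"
    have "x * z x * e * x = x * z x * (e * x)" by (simp add: mult.assoc)
    also have "\<dots> = x" using X x z by auto
    finally have 1: "x * z x * e * x = x" .
    have "h * (x * z x * e) = x * z x * e" using h(3) x by (simp add: G_def)
    then have "h * (x * z x * e) * x = x * z x * e * x" by (rule arg_cong)
    then show "h * x = x" by (simp only: mult.assoc 1[unfolded mult.assoc])
  next
    fix y assume y: "y \<in> Y"
    have "y * (e * z y * y) = (y * e) * z y * y" by (simp add: mult.assoc)
    also have "\<dots> = y" using Y y z by auto
    finally have 1: "y * (e * z y * y) = y" .
    have "(e * z y * y) * h = e * z y * y" using h(3) y by (simp add: G_def)
    then have "y * ((e * z y * y) * h) = y * (e * z y * y)" by (rule arg_cong)
    then show "y * h = y" by (simp only: mult.assoc[symmetric] 1[unfolded mult.assoc[symmetric]])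
  qed (use h in auto)
qed

text \<open>With y = x - x^2 = y z y and f = y z, the right ideal f J is stable under left
  multiplication by x because x commutes with y; hence x - f x is idempotent.\<close>

lemma lift_idempotent:
  assumes x: "x \<in> R" "x * x \<approx> x" and u: "u \<in> R" "u * u = u" "u * x = 0" "x * u = 0"
  shows "\<exists>e\<in>R. e * e = e \<and> e \<approx> x \<and> u * e = 0 \<and> e * u = 0"
proof -
  define y where "y = x - x * x"
  have ux: "u * (x * t) = 0" for t using u by (simp add: mult.assoc[symmetric])
  have yJ: "y \<in> J" using cong_sym[OF x(2)] by (simp add: y_def cong_def)
  then obtain z where z: "z \<in> J" "y * z * y = y" using regular_ringD(5)[OF J_regular] by blast
  define f where "f = y * z"
  have fJ: "f \<in> J" using z yJ by (simp add: f_def J_closed)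
  have fy: "f * y = y" using z by (simp add: f_def)
  have xy: "x * y = y * x" by (simp add: y_def algebra_simps)
  have xf: "x * f = f * (x * f)"
  proof -
    have "f * (x * f) = f * (x * y * z)" by (simp add: f_def mult.assoc)
    also have "\<dots> = f * y * (x * z)" by (simp add: xy mult.assoc)
    also have "\<dots> = y * (x * z)" by (simp only: fy)
    also have "\<dots> = x * f" by (simp add: f_def mult.assoc[symmetric] xy)
    finally show ?thesis by simp
  qed
  have xx: "x * x = x - y" by (simp add: y_def)
  define e where "e = x - f * x"
  have xfx: "x * (f * x) = f * (x * (f * x))" by (metis xf mult.assoc)
  have "e * e = x * x - f * (x * x) - (x * (f * x) - f * (x * (f * x)))"
    by (simp add: e_def algebra_simps)
  also have "\<dots> = e" by (simp add: xfx[symmetric] xx right_diff_distrib fy e_def)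
  finally have "e * e = e" .
  moreover have "e \<in> R" using x fJ by (simp add: e_def R_closed J_in_R)
  moreover have "e \<approx> x"
    using cong_diff[OF cong_refl[of x], of "f * x" 0] x fJ
    by (simp add: e_def cong_0 J_right)
  moreover have "u * e = 0"
    by (simp add: e_def algebra_simps u f_def y_def ux)
  moreover have "e * u = 0" using u by (simp add: e_def algebra_simps)
  ultimately show ?thesis by blast
qed

text \<open>The lifts are found one at a time. The sum \<open>u\<close> of those already found is an
  idempotent, and each of them absorbs \<open>u\<close>; a new lift annihilated by \<open>u\<close>
  on both sides is therefore orthogonal to all of them.\<close>

lemma lift_orthogonal_idempotents:
  assumes "finite P" "\<And>p. p \<in> P \<Longrightarrow> x p \<in> R"
    "\<And>p q. p \<in> P \<Longrightarrow> q \<in> P \<Longrightarrow> x p * x q \<approx> (if p = q then x p else 0)"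
  shows "\<exists>e. \<forall>p\<in>P. e p \<in> R \<and> e p \<approx> x p \<and> (\<forall>q\<in>P. e p * e q = (if p = q then e p else 0))"
  using assms
proof (induction P rule: finite_induct)
  case (insert p P)
  have "\<exists>e. \<forall>p\<in>P. e p \<in> R \<and> e p \<approx> x p \<and> (\<forall>q\<in>P. e p * e q = (if p = q then e p else 0))"
    by (intro insert.IH insert.prems) auto
  then obtain e where "\<forall>p\<in>P. e p \<in> R \<and> e p \<approx> x p \<and>
      (\<forall>q\<in>P. e p * e q = (if p = q then e p else 0))" ..
  then have e: "\<And>q. q \<in> P \<Longrightarrow> e q \<in> R" "\<And>q. q \<in> P \<Longrightarrow> e q \<approx> x q"
    "\<And>q r. q \<in> P \<Longrightarrow> r \<in> P \<Longrightarrow> e q * e r = (if q = r then e q else 0)"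
    by simp_all
  define u where "u = sum e P"
  have uR: "u \<in> R" using e by (simp add: u_def R_sum)
  have ue: "u * e q = e q" "e q * u = e q" if "q \<in> P" for q
    using that insert.hyps e by (simp_all add: u_def sum_distrib_left sum_distrib_right)
  have uu: "u * u = u" by (subst (2) u_def, simp add: sum_distrib_left ue) (simp add: u_def)
  have xR: "x p \<in> R" using insert.prems by simp
  have uxp: "u * x p \<approx> 0"
    unfolding u_def sum_distrib_right
  proof (rule cong_0_sum)
    fix q assume q: "q \<in> P"
    have 0: "x q * x p \<approx> 0" using insert.prems(2)[of q p] q insert.hyps by (auto split: if_splits)
    show "e q * x p \<approx> 0"
      by (rule cong_mult2[OF e(2)[OF q] cong_refl _ _ 0]) (use q insert.prems in auto)
  qed
  have xpu: "x p * u \<approx> 0"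
    unfolding u_def sum_distrib_left
  proof (rule cong_0_sum)
    fix q assume q: "q \<in> P"
    have 0: "x p * x q \<approx> 0" using insert.prems(2)[of p q] q insert.hyps by (auto split: if_splits)
    show "x p * e q \<approx> 0"
      by (rule cong_mult2[OF cong_refl e(2)[OF q] _ _ 0]) (use q e insert.prems in auto)
  qed
  \<comment> \<open>(1 - u) (x p) (1 - u) in expanded form: exactly orthogonal to \<open>u\<close>,
    and still congruent to \<open>x p\<close> because \<open>u * x p\<close> and
    \<open>x p * u\<close> lie in \<open>J\<close>.\<close>
  define y where "y = x p - u * x p - x p * u + u * x p * u"
  have yR: "y \<in> R" using uR xR by (simp add: y_def R_closed)
  have "y - x p = u * x p * u - u * x p - x p * u" by (simp add: y_def)
  also have "\<dots> \<in> J" using uxp xpu uR by (simp add: cong_0 J_closed J_right)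
  finally have yx: "y \<approx> x p" by (simp add: cong_def)
  have uut: "u * (u * t) = u * t" for t using uu by (simp add: mult.assoc[symmetric])
  have uy: "u * y = 0" "y * u = 0" by (simp_all add: y_def algebra_simps uu uut)
  have "x p * x p \<approx> x p" using insert.prems(2)[of p p] by simp
  then have "y * y \<approx> x p" using cong_mult2[OF yx yx] xR yR by blast
  then have "y * y \<approx> y" using yx cong_sym cong_trans by blast
  then obtain f where f: "f \<in> R" "f * f = f" "f \<approx> y" "u * f = 0" "f * u = 0"
    using lift_idempotent[OF yR _ uR uu uy] by blast
  have fx: "f \<approx> x p" using f(3) yx cong_trans by blast
  have ef: "e q * f = 0" "f * e q = 0" if "q \<in> P" for q
  proof -
    have "e q * f = e q * u * f" "f * e q = f * (u * e q)" using ue that by simp_all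
    then show "e q * f = 0" "f * e q = 0" using f by (simp add: mult.assoc, simp add: mult.assoc[symmetric])
  qed
  show ?case
  proof (intro exI[of _ "e(p := f)"] ballI conjI)
    fix q assume q: "q \<in> insert p P"
    show "(e(p := f)) q \<in> R" "(e(p := f)) q \<approx> x q" using q e(1,2) f(1) fx by auto
    fix r assume r: "r \<in> insert p P"
    show "(e(p := f)) q * (e(p := f)) r = (if q = r then (e(p := f)) q else 0)"
      using q r insert.hyps e(3) ef f(2) by auto
  qed
qed simp

end

section \<open>Matrix units\<close>

text \<open>Every block has its own index set, possibly empty, over arbitrary index types: passing
  to a corner discards indices, and two systems are later joined over a disjoint sum. Nonzero
  diagonal units force the others to be nonzero, because
  \<open>E i r s * E i s r = E i r r\<close>.\<close>

locale matrix_units =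
  fixes I :: "'i set" and N :: "'i \<Rightarrow> 'n set" and E :: "'i \<Rightarrow> 'n \<Rightarrow> 'n \<Rightarrow> 'b::ring"
  assumes finite_I: "finite I" and finite_N: "i \<in> I \<Longrightarrow> finite (N i)"
    and unit_nonzero: "i \<in> I \<Longrightarrow> r \<in> N i \<Longrightarrow> E i r r \<noteq> 0"
    and unit_mult: "i \<in> I \<Longrightarrow> r \<in> N i \<Longrightarrow> s \<in> N i \<Longrightarrow> j \<in> I \<Longrightarrow> t \<in> N j \<Longrightarrow> u \<in> N j \<Longrightarrow>
      E i r s * E j t u = (if i = j \<and> s = t then E i r u else 0)"

definition unit_set :: "'i set \<Rightarrow> ('i \<Rightarrow> 'n set) \<Rightarrow> ('i \<Rightarrow> 'n \<Rightarrow> 'n \<Rightarrow> 'b) \<Rightarrow> 'b set" where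
  "unit_set I N E = {E i r s | i r s. i \<in> I \<and> r \<in> N i \<and> s \<in> N i}"

lemma unit_setI: "i \<in> I \<Longrightarrow> r \<in> N i \<Longrightarrow> s \<in> N i \<Longrightarrow> E i r s \<in> unit_set I N E"
  by (auto simp: unit_set_def)

lemma unit_setE:
  assumes "x \<in> unit_set I N E"
  obtains i r s where "i \<in> I" "r \<in> N i" "s \<in> N i" "x = E i r s"
  using assms by (auto simp: unit_set_def)

locale type_algebra = vector_space scale
  for scale :: "'k::field \<Rightarrow> 'b::ring \<Rightarrow> 'b" (infixr \<open>*s\<close> 75) +
  assumes scale_mult_left: "(a *s x) * y = a *s (x * y)"
    and scale_mult_right: "x * (a *s y) = a *s (x * y)"

locale unit_algebra = type_algebra scale + matrix_units I N E
  for scale :: "'k::field \<Rightarrow> 'b::ring \<Rightarrow> 'b" (infixr \<open>*s\<close> 75)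
    and I :: "'i set" and N :: "'i \<Rightarrow> 'n set" and E :: "'i \<Rightarrow> 'n \<Rightarrow> 'n \<Rightarrow> 'b"
begin

abbreviation "\<A> \<equiv> span (unit_set I N E)"

lemma unit_in: "i \<in> I \<Longrightarrow> r \<in> N i \<Longrightarrow> s \<in> N i \<Longrightarrow> E i r s \<in> \<A>"
  by (intro span_base unit_setI)

lemma mult_in:
  assumes x: "x \<in> \<A>" and y: "y \<in> \<A>"
  shows "x * y \<in> \<A>"
  using x
proof (induction rule: span_induct)
  show "subspace {x. x * y \<in> \<A>}"
    by (auto simp: subspace_def distrib_right scale_mult_left span_zero span_add span_scale)
  fix a assume a: "a \<in> unit_set I N E"
  show "a * y \<in> \<A>" using y
  proof (induction rule: span_induct)
    show "subspace {y. a * y \<in> \<A>}"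
      by (auto simp: subspace_def distrib_left scale_mult_right span_zero span_add span_scale)
    fix b assume "b \<in> unit_set I N E"
    with a show "a * b \<in> \<A>"
      by (auto elim!: unit_setE simp: unit_mult unit_in span_zero)
  qed
qed

text \<open>The identity of the span, even if the ring type has none. Orthogonality to the whole
  system is later expressed through this single idempotent.\<close>

definition one :: 'b where "one = (\<Sum>(i, r)\<in>Sigma I N. E i r r)"

lemma finite_Sigma_IN: "finite (Sigma I N)"
  using finite_I finite_N by blast

lemma one_mult_unit:
  assumes "i \<in> I" "r \<in> N i" "s \<in> N i"
  shows "one * E i r s = E i r s" "E i r s * one = E i r s"
proof -
  have "one * E i r s = (\<Sum>p\<in>Sigma I N. if p = (i, r) then E i r s else 0)"
    unfolding one_def sum_distrib_right
    by (rule sum.cong) (use assms in \<open>auto simp: unit_mult split: if_splits\<close>)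
  then show "one * E i r s = E i r s" using assms finite_Sigma_IN by simp
  have "E i r s * one = (\<Sum>p\<in>Sigma I N. if p = (i, s) then E i r s else 0)"
    unfolding one_def sum_distrib_left
    by (rule sum.cong) (use assms in \<open>auto simp: unit_mult split: if_splits\<close>)
  then show "E i r s * one = E i r s" using assms finite_Sigma_IN by simp
qed

lemma one_mult: "x \<in> \<A> \<Longrightarrow> one * x = x"
proof (induction rule: span_induct)
  show "subspace {x. one * x = x}"
    by (auto simp: subspace_def distrib_left scale_mult_right)
qed (auto elim!: unit_setE simp: one_mult_unit)

lemma mult_one: "x \<in> \<A> \<Longrightarrow> x * one = x"
proof (induction rule: span_induct)
  show "subspace {x. x * one = x}"
    by (auto simp: subspace_def distrib_right scale_mult_left)
qed (auto elim!: unit_setE simp: one_mult_unit)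

lemma one_in: "one \<in> \<A>"
  unfolding one_def by (rule span_sum) (auto simp: unit_in)

lemma one_one: "one * one = one" using one_in one_mult by blast

section \<open>Matrix entries, pivots and row elimination\<close>

lemma corner_scalar:
  assumes ir: "i \<in> I" "r \<in> N i" and js: "j \<in> I" "s \<in> N j" and x: "x \<in> \<A>"
  shows "\<exists>a. E i r r * x * E j s s = a *s (if i = j then E i r s else 0)"
  using x
proof (induction rule: span_induct)
  show "subspace {x. \<exists>a. E i r r * x * E j s s = a *s (if i = j then E i r s else 0)}"
    unfolding subspace_def
  proof (intro conjI ballI allI CollectI)
    show "\<exists>a. E i r r * 0 * E j s s = a *s (if i = j then E i r s else 0)"
      by (rule exI[of _ 0]) simp
    fix x assume x: "x \<in> {x. \<exists>a. E i r r * x * E j s s = a *s (if i = j then E i r s else 0)}"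
    then obtain a where a: "E i r r * x * E j s s = a *s (if i = j then E i r s else 0)" by blast
    show "\<exists>a. E i r r * (c *s x) * E j s s = a *s (if i = j then E i r s else 0)" for c
      by (rule exI[of _ "c * a"]) (simp add: scale_mult_left scale_mult_right a)
    fix y assume "y \<in> {x. \<exists>a. E i r r * x * E j s s = a *s (if i = j then E i r s else 0)}"
    then obtain b where b: "E i r r * y * E j s s = b *s (if i = j then E i r s else 0)" by blast
    show "\<exists>a. E i r r * (x + y) * E j s s = a *s (if i = j then E i r s else 0)"
      by (rule exI[of _ "a + b"]) (simp add: distrib_left distrib_right a b scale_left_distrib)
  qed
  fix b assume "b \<in> unit_set I N E"
  then obtain k t u where b: "k \<in> I" "t \<in> N k" "u \<in> N k" "b = E k t u" by (elim unit_setE)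
  show "\<exists>a. E i r r * b * E j s s = a *s (if i = j then E i r s else 0)"
  proof (cases "i = k \<and> r = t \<and> k = j \<and> u = s")
    case True
    then show ?thesis using b ir js by (intro exI[of _ 1]) (auto simp: unit_mult)
  next
    case False
    then show ?thesis using b ir js by (intro exI[of _ 0]) (auto simp: unit_mult)
  qed
qed

text \<open>The nonzero rows: their number is the termination measure of the eliminations below, and
  they supply the indices for the matrix units of a corner.\<close>

definition rows :: "'b \<Rightarrow> ('i \<times> 'n) set" where
  "rows x = {(i, r) \<in> Sigma I N. E i r r * x \<noteq> 0}"

lemma finite_rows: "finite (rows x)"
  using finite_Sigma_IN by (rule finite_subset[rotated]) (auto simp: rows_def)

text \<open>Since \<open>x = one * x * one\<close>, the element is the sum of its two-sided
  compressions, so one of these is nonzero; compressions between different blocks vanish.\<close>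

lemma pivot:
  assumes x: "x \<in> \<A>" "x \<noteq> 0"
  obtains i r s a where "i \<in> I" "r \<in> N i" "s \<in> N i" "a \<noteq> 0" "E i r r * x * E i s s = a *s E i r s"
proof -
  have "\<exists>(i, r)\<in>Sigma I N. \<exists>(j, s)\<in>Sigma I N. E i r r * x * E j s s \<noteq> 0"
  proof (rule ccontr)
    assume 0: "\<not> ?thesis"
    have "x = one * x * one" using x by (simp add: one_mult mult_one)
    also have "\<dots> = (\<Sum>(i, r)\<in>Sigma I N. \<Sum>(j, s)\<in>Sigma I N. E i r r * x * E j s s)"
      by (simp add: one_def sum_distrib_left sum_distrib_right case_prod_unfold)
        (subst sum.swap, simp)
    also have "\<dots> = 0" using 0 by (intro sum.neutral) (auto intro!: sum.neutral)
    finally show False using x by simp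
  qed
  then obtain i r j s where ir: "i \<in> I" "r \<in> N i" "j \<in> I" "s \<in> N j" and ne: "E i r r * x * E j s s \<noteq> 0"
    by auto
  obtain a where a: "E i r r * x * E j s s = a *s (if i = j then E i r s else 0)"
    using corner_scalar[OF ir x(1)] by blast
  with ne have "i = j" "a \<noteq> 0" by (auto split: if_splits)
  then show thesis using that ir a by auto
qed

text \<open>The update subtracts x y x with y = a^-1 E_sr. Because the (r, s) entry of
  \<open>x\<close> is \<open>a\<close>, compression gives E_rr x y x = E_rr x, which clears row r. A
  zero row stays zero because both terms of the update begin with \<open>x\<close>.\<close>

lemma eliminate_row:
  assumes ir: "i \<in> I" "r \<in> N i" "s \<in> N i" "a \<noteq> 0"
    and a: "E i r r * x * E i s s = a *s E i r s"
  shows "rows (x - x * (inverse a *s E i s r) * x) \<subset> rows x"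
    "(i, r) \<in> rows x" "(i, r) \<notin> rows (x - x * (inverse a *s E i s r) * x)"
proof -
  let ?x = "x - x * (inverse a *s E i s r) * x"
  have Eir: "E i r s \<noteq> 0"
  proof
    assume "E i r s = 0"
    then have "E i r s * E i s r = 0" by simp
    then show False using ir unit_nonzero by (simp add: unit_mult)
  qed
  have "E i r r * x \<noteq> 0"
  proof
    assume "E i r r * x = 0"
    then show False using a Eir ir by simp
  qed
  then show 1: "(i, r) \<in> rows x" using ir by (simp add: rows_def)
  have "E i r r * x * E i s r = (E i r r * x * E i s s) * E i s r"
    using ir by (simp add: mult.assoc unit_mult)
  also have "\<dots> = a *s E i r r" unfolding a using ir by (simp add: scale_mult_left unit_mult)
  finally have "E i r r * x * E i s r * x = a *s (E i r r * x)" by (simp add: scale_mult_left)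
  then have "E i r r * ?x = 0"
    using ir by (simp add: right_diff_distrib scale_mult_left scale_mult_right mult.assoc)
  then show 2: "(i, r) \<notin> rows ?x" by (simp add: rows_def)
  have "rows ?x \<subseteq> rows x"
    by (auto simp: rows_def right_diff_distrib mult.assoc[symmetric])
  then show "rows ?x \<subset> rows x" using 1 2 by blast
qed

text \<open>McCoy: if x - x y x is regular then so is x, and a pivot y reduces the number of
  nonzero rows.\<close>

lemma regular_element:
  assumes "x \<in> \<A>"
  shows "\<exists>z\<in>\<A>. x * z * x = x"
  using assms
proof (induction "card (rows x)" arbitrary: x rule: less_induct)
  case less
  show ?case
  proof (cases "x = 0")
    case True
    then show ?thesis using span_zero by (intro bexI[of _ 0]) auto
  next
    case False
    then obtain i r s a where ir: "i \<in> I" "r \<in> N i" "s \<in> N i" "a \<noteq> 0"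
      and a: "E i r r * x * E i s s = a *s E i r s"
      using pivot less.prems by blast
    define y where "y = inverse a *s E i s r"
    define x' where "x' = x - x * y * x"
    have y: "y \<in> \<A>" using ir by (simp add: y_def span_scale unit_in)
    then have x': "x' \<in> \<A>" using less.prems by (simp add: x'_def span_diff mult_in)
    have "card (rows x') < card (rows x)"
      using eliminate_row(1)[OF ir a] finite_rows by (simp add: x'_def y_def psubset_card_mono)
    then obtain z where z: "z \<in> \<A>" "x' * z * x' = x'" using less.hyps x' by blast
    \<comment> \<open>The quasi-inverse is y + (1 - y x) z (1 - x y) in expanded form; the outer
      factors turn \<open>x\<close> into \<open>x'\<close> on either side of
      \<open>z\<close>.\<close>
    define w where "w = y + z - y * x * z - z * x * y + y * x * z * x * y"
    have "x * w * x = x * y * x + x' * z * x'"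
      by (simp add: w_def x'_def algebra_simps)
    also have "\<dots> = x" using z by (simp add: x'_def)
    finally have "x * w * x = x" .
    moreover have "w \<in> \<A>"
      unfolding w_def using y z less.prems by (intro span_add span_diff mult_in)
    ultimately show ?thesis by blast
  qed
qed

text \<open>A rank factorization h = V W for which W V is the diagonal of units indexed by
  \<open>Q\<close>. Each pivot splits an idempotent \<open>v0 * w0\<close> off \<open>h\<close>,
  orthogonal to the remainder. Indexing by pivot rows records the rank in each block without
  counting it.\<close>

lemma idempotent_decomposition:
  assumes "h \<in> \<A>" "h * h = h"
  shows "\<exists>Q v w. Q \<subseteq> rows h \<and> h = (\<Sum>p\<in>Q. v p * w p) \<and>
    (\<forall>p\<in>Q. v p \<in> \<A> \<and> w p \<in> \<A> \<and>
       v p * E (fst p) (snd p) (snd p) = v p \<and> E (fst p) (snd p) (snd p) * w p = w p \<and>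
       (\<forall>q\<in>Q. w p * v q = (if p = q then E (fst p) (snd p) (snd p) else 0)))"
  using assms
proof (induction "card (rows h)" arbitrary: h rule: less_induct)
  case less
  show ?case
  proof (cases "h = 0")
    case True
    then show ?thesis by (intro exI[of _ "{}"]) auto
  next
    case False
    then obtain i r s a where ir: "i \<in> I" "r \<in> N i" "s \<in> N i" "a \<noteq> 0"
      and a: "E i r r * h * E i s s = a *s E i r s"
      using pivot less.prems by blast
    \<comment> \<open>A pivot column and a pivot row of \<open>h\<close>; the factor
      \<open>inverse a\<close> in \<open>w0\<close> normalizes \<open>w0 * v0\<close> to
      \<open>E i r r\<close>. The remainder \<open>h'\<close> is exactly the result of eliminating
      row \<open>r\<close>, so the measure drops.\<close>
    define v0 where "v0 = h * E i s r"
    define w0 where "w0 = inverse a *s (E i r r * h)"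
    define h' where "h' = h - v0 * w0"
    have h'_eq: "h' = h - h * (inverse a *s E i s r) * h"
      using ir by (simp add: h'_def v0_def w0_def scale_mult_left scale_mult_right mult.assoc)
        (simp add: mult.assoc[symmetric] unit_mult)
    have inA: "v0 \<in> \<A>" "w0 \<in> \<A>"
      using ir less.prems by (simp_all add: v0_def w0_def span_scale mult_in unit_in)
    then have h'A: "h' \<in> \<A>" using less.prems by (simp add: h'_def span_diff mult_in)
    have hh: "h * (h * t) = h * t" for t using less.prems by (simp add: mult.assoc[symmetric])
    have hv: "h * v0 = v0" by (simp add: v0_def hh)
    have wh: "w0 * h = w0" using less.prems by (simp add: w0_def scale_mult_left mult.assoc)
    have Ew: "E i r r * w0 = w0"
      using ir by (simp add: w0_def scale_mult_right mult.assoc[symmetric] unit_mult)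
    have vE: "v0 * E i r r = v0" using ir by (simp add: v0_def mult.assoc unit_mult)
    have "w0 * v0 = inverse a *s (E i r r * h * E i s r)"
      by (simp add: w0_def v0_def scale_mult_left mult.assoc hh)
    also have "E i r r * h * E i s r = (E i r r * h * E i s s) * E i s r"
      using ir by (simp add: mult.assoc unit_mult)
    also have "\<dots> = a *s E i r r" unfolding a using ir by (simp add: scale_mult_left unit_mult)
    finally have wv: "w0 * v0 = E i r r" using ir by simp
    have wh': "w0 * h' = 0"
      by (simp add: h'_def right_diff_distrib wh mult.assoc[symmetric] wv Ew)
    have h'v: "h' * v0 = 0"
      by (simp add: h'_def left_diff_distrib hv mult.assoc wv vE)
    have hh': "h * h' = h'"
      using less.prems by (simp add: h'_def right_diff_distrib mult.assoc[symmetric] hv)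
    have "h' * h' = h * h' - v0 * (w0 * h')"
      by (subst h'_def) (simp add: left_diff_distrib mult.assoc)
    then have h'h': "h' * h' = h'" by (simp add: hh' wh')
    have "card (rows h') < card (rows h)"
      using eliminate_row(1)[OF ir a] finite_rows by (simp add: h'_eq psubset_card_mono)
    from less.hyps[OF this h'A h'h'] obtain Q v w where Q: "Q \<subseteq> rows h'"
      and sum: "h' = (\<Sum>p\<in>Q. v p * w p)"
      and vw: "\<And>p. p \<in> Q \<Longrightarrow> v p \<in> \<A>" "\<And>p. p \<in> Q \<Longrightarrow> w p \<in> \<A>"
        "\<And>p. p \<in> Q \<Longrightarrow> v p * E (fst p) (snd p) (snd p) = v p"
        "\<And>p. p \<in> Q \<Longrightarrow> E (fst p) (snd p) (snd p) * w p = w p"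
        "\<And>p q. p \<in> Q \<Longrightarrow> q \<in> Q \<Longrightarrow> w p * v q = (if p = q then E (fst p) (snd p) (snd p) else 0)"
      by (elim exE conjE) (simp only: Ball_def)
    have finQ: "finite Q" using Q finite_rows finite_subset by blast
    have h'vp: "h' * v p = v p" if "p \<in> Q" for p
    proof -
      have "h' * v p = (\<Sum>q\<in>Q. v q * (w q * v p))" by (simp add: sum sum_distrib_right mult.assoc)
      also have "\<dots> = (\<Sum>q\<in>Q. if q = p then v p else 0)"
        by (rule sum.cong) (use vw that in auto)
      finally show ?thesis using finQ that by simp
    qed
    have wph': "w p * h' = w p" if "p \<in> Q" for p
    proof -
      have "w p * h' = (\<Sum>q\<in>Q. (w p * v q) * w q)" by (simp add: sum sum_distrib_left mult.assoc)
      also have "\<dots> = (\<Sum>q\<in>Q. if q = p then w p else 0)"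
        by (rule sum.cong) (use vw that in auto)
      finally show ?thesis using finQ that by simp
    qed
    have w0v: "w0 * v p = 0" if "p \<in> Q" for p
    proof -
      have "w0 * v p = w0 * h' * v p" using h'vp[OF that] by (simp add: mult.assoc)
      then show ?thesis by (simp add: wh')
    qed
    have wv0: "w p * v0 = 0" if "p \<in> Q" for p
    proof -
      have "w p * v0 = w p * h' * v0" using wph'[OF that] by simp
      then show ?thesis by (simp add: h'v mult.assoc)
    qed
    have notin: "(i, r) \<notin> Q" using Q eliminate_row(3)[OF ir a] by (auto simp: h'_eq)
    have "Q \<subseteq> rows h" using Q eliminate_row(1)[OF ir a] by (auto simp: h'_eq)
    then have Qh: "insert (i, r) Q \<subseteq> rows h" using eliminate_row(2)[OF ir a] by simp
    let ?v = "v((i, r) := v0)" and ?w = "w((i, r) := w0)"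
    have "(\<Sum>p\<in>insert (i, r) Q. ?v p * ?w p) = v0 * w0 + (\<Sum>p\<in>Q. ?v p * ?w p)"
      using finQ notin by simp
    also have "(\<Sum>p\<in>Q. ?v p * ?w p) = h'"
      unfolding sum by (rule sum.cong) (use notin in auto)
    finally have sum': "h = (\<Sum>p\<in>insert (i, r) Q. ?v p * ?w p)" by (simp add: h'_def)
    show ?thesis
    proof (rule exI[of _ "insert (i, r) Q"], rule exI[of _ ?v], rule exI[of _ ?w], intro conjI ballI Qh sum')
      fix p assume p: "p \<in> insert (i, r) Q"
      show "?v p \<in> \<A>" "?w p \<in> \<A>" "?v p * E (fst p) (snd p) (snd p) = ?v p"
        "E (fst p) (snd p) (snd p) * ?w p = ?w p"
        using p by (auto simp: vw(1-4) inA vE Ew)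
      fix q assume q: "q \<in> insert (i, r) Q"
      show "?w p * ?v q = (if p = q then E (fst p) (snd p) (snd p) else 0)"
        using p q notin by (auto simp: vw(5) w0v wv0 wv)
    qed
  qed
qed

text \<open>The factors of the decomposition transport the old units into the corner:
  \<open>E' i r s = v (i, r) * E i r s * w (i, s)\<close>. They span it because h x h is the sum of
  all v_p (w_p x v_q) w_q, and inserting diagonal units on both sides reduces the middle factor to a
  scalar multiple of a unit, or to zero across blocks.\<close>

lemma corner_matrix_units:
  assumes h: "h \<in> \<A>" "h * h = h"
  shows "\<exists>(N' :: 'i \<Rightarrow> 'n set) E'. matrix_units I N' E' \<and> unit_set I N' E' \<subseteq> \<A> \<and>
    (\<forall>e\<in>unit_set I N' E'. h * e = e \<and> e * h = e) \<and>
    (\<forall>x\<in>\<A>. h * x * h \<in> span (unit_set I N' E'))"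
proof -
  from idempotent_decomposition[OF h] obtain Q v w where Q: "Q \<subseteq> rows h"
    and sum: "h = (\<Sum>p\<in>Q. v p * w p)"
    and vw: "\<And>p. p \<in> Q \<Longrightarrow> v p \<in> \<A>" "\<And>p. p \<in> Q \<Longrightarrow> w p \<in> \<A>"
      "\<And>p. p \<in> Q \<Longrightarrow> v p * E (fst p) (snd p) (snd p) = v p"
      "\<And>p. p \<in> Q \<Longrightarrow> E (fst p) (snd p) (snd p) * w p = w p"
      "\<And>p q. p \<in> Q \<Longrightarrow> q \<in> Q \<Longrightarrow> w p * v q = (if p = q then E (fst p) (snd p) (snd p) else 0)"
    by (elim exE conjE) (simp only: Ball_def)
  have finQ: "finite Q" using Q finite_rows finite_subset by blast
  define N' where "N' i = {r. (i, r) \<in> Q}" for i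
  define E' where "E' i r s = v (i, r) * E i r s * w (i, s)" for i r s
  have Q_in: "i \<in> I" "r \<in> N i" if "(i, r) \<in> Q" for i r
    using that Q by (auto simp: rows_def)
  have E'_mult: "E' i r s * E' j t u = (if i = j \<and> s = t then E' i r u else 0)"
    if "(i, r) \<in> Q" "(i, s) \<in> Q" "(j, t) \<in> Q" "(j, u) \<in> Q" for i r s j t u
  proof -
    have "E' i r s * E' j t u = v (i, r) * E i r s * (w (i, s) * v (j, t)) * E j t u * w (j, u)"
      by (simp add: E'_def mult.assoc)
    also have "\<dots> = (if i = j \<and> s = t then v (i, r) * ((E i r s * E i s s) * E i s u) * w (i, u) else 0)"
      using that by (simp add: vw(5) mult.assoc)
    also have "\<dots> = (if i = j \<and> s = t then E' i r u else 0)"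
      using that Q_in by (auto simp: unit_mult E'_def)
    finally show ?thesis .
  qed
  have hv: "h * v p = v p" if "p \<in> Q" for p
  proof -
    have "h * v p = (\<Sum>q\<in>Q. v q * (w q * v p))" by (simp add: sum sum_distrib_right mult.assoc)
    also have "\<dots> = (\<Sum>q\<in>Q. if q = p then v p else 0)"
      by (rule sum.cong) (use vw that in auto)
    finally show ?thesis using finQ that by simp
  qed
  have wh: "w p * h = w p" if "p \<in> Q" for p
  proof -
    have "w p * h = (\<Sum>q\<in>Q. (w p * v q) * w q)" by (simp add: sum sum_distrib_left mult.assoc)
    also have "\<dots> = (\<Sum>q\<in>Q. if q = p then w p else 0)"
      by (rule sum.cong) (use vw that in auto)
    finally show ?thesis using finQ that by simp
  qed
  have mu: "matrix_units I N' E'"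
  proof
    show "finite I" by (rule finite_I)
    show "finite (N' i)" if "i \<in> I" for i
      using finite_N[OF that] by (rule finite_subset[rotated]) (auto simp: N'_def Q_in)
    show "E' i r r \<noteq> 0" if "i \<in> I" "r \<in> N' i" for i r
    proof
      assume 0: "E' i r r = 0"
      have ir: "(i, r) \<in> Q" using that by (simp add: N'_def)
      \<comment> \<open>Undoing the transport recovers \<open>E i r r\<close>, so a vanishing new
        unit would make an old one vanish.\<close>
      have "w (i, r) * E' i r r * v (i, r) = (w (i, r) * v (i, r)) * E i r r * (w (i, r) * v (i, r))"
        by (simp add: E'_def mult.assoc)
      also have "\<dots> = E i r r" using ir Q_in[OF ir] by (simp add: vw(5) unit_mult)
      finally show False using 0 unit_nonzero Q_in[OF ir] by simp
    qed
    show "E' i r s * E' j t u = (if i = j \<and> s = t then E' i r u else 0)"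
      if "r \<in> N' i" "s \<in> N' i" "t \<in> N' j" "u \<in> N' j" for i r s j t u
      using that E'_mult by (simp add: N'_def)
  qed
  have E'_in: "E' i r s \<in> unit_set I N' E'" if "(i, r) \<in> Q" "(i, s) \<in> Q" for i r s
    using that Q_in by (intro unit_setI) (auto simp: N'_def)
  have elim: "\<exists>i r s. (i, r) \<in> Q \<and> (i, s) \<in> Q \<and> e = E' i r s" if "e \<in> unit_set I N' E'" for e
    using that unfolding unit_set_def N'_def by blast
  have sub: "unit_set I N' E' \<subseteq> \<A>"
  proof
    fix e assume "e \<in> unit_set I N' E'"
    then obtain i r s where e: "(i, r) \<in> Q" "(i, s) \<in> Q" "e = E' i r s" using elim by blast
    then show "e \<in> \<A>" using vw(1,2) Q_in by (auto simp: E'_def intro!: mult_in unit_in)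
  qed
  have he: "\<forall>e\<in>unit_set I N' E'. h * e = e \<and> e * h = e"
  proof
    fix e assume "e \<in> unit_set I N' E'"
    then obtain i r s where e: "(i, r) \<in> Q" "(i, s) \<in> Q" "e = E' i r s" using elim by blast
    then show "h * e = e \<and> e * h = e"
      using hv wh by (simp add: E'_def mult.assoc) (simp add: mult.assoc[symmetric])
  qed
  have "\<forall>x\<in>\<A>. h * x * h \<in> span (unit_set I N' E')"
  proof
    fix x assume x: "x \<in> \<A>"
    have "h * x * h = (\<Sum>p\<in>Q. v p * w p) * x * (\<Sum>q\<in>Q. v q * w q)" by (simp add: sum[symmetric])
    also have "\<dots> = (\<Sum>q\<in>Q. \<Sum>p\<in>Q. v p * w p * x * (v q * w q))"
      by (simp add: sum_distrib_left sum_distrib_right)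
    also have "\<dots> \<in> span (unit_set I N' E')"
    proof (intro span_sum)
      fix p q assume pq: "p \<in> Q" "q \<in> Q"
      obtain i r j s where p: "p = (i, r)" and q: "q = (j, s)" by (cases p, cases q)
      have ir: "i \<in> I" "r \<in> N i" "j \<in> I" "s \<in> N j" using pq p q Q_in by auto
      have "w p * x * v q \<in> \<A>" using vw pq x by (intro mult_in)
      then obtain a where a: "E i r r * (w p * x * v q) * E j s s = a *s (if i = j then E i r s else 0)"
        using corner_scalar[OF ir] by blast
      have "v p * w p * x * (v q * w q) = (v p * E i r r) * (E i r r * w p) * x * ((v q * E j s s) * (E j s s * w q))"
        using vw(3,4)[OF pq(1)] vw(3,4)[OF pq(2)] p q by simp
      also have "\<dots> = v p * ((E i r r * E i r r) * (w p * x * v q) * (E j s s * E j s s)) * w q"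
        by (simp add: mult.assoc)
      also have "\<dots> = v p * (a *s (if i = j then E i r s else 0)) * w q"
        using ir a by (simp add: unit_mult)
      also have "\<dots> = a *s (if i = j then E' i r s else 0)"
        by (simp add: E'_def p q scale_mult_left scale_mult_right)
      also have "\<dots> \<in> span (unit_set I N' E')"
        using pq p q by (auto simp: E'_in span_base span_zero intro!: span_scale)
      finally show "v p * w p * x * (v q * w q) \<in> span (unit_set I N' E')" .
    qed
    finally show "h * x * h \<in> span (unit_set I N' E')" .
  qed
  with mu sub he show ?thesis by (intro exI[of _ N'] exI[of _ E'] conjI)
qed

end

section \<open>Extensions\<close>

text \<open>The quotient enters through representatives \<open>x\<close> of matrix units and
  congruences modulo \<open>J\<close>. In the sum index type of the conclusion, the left summand
  carries the lifted blocks and the right summand the blocks inside \<open>J\<close>.\<close>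

lemma (in type_algebra) extension_matrix_units:
  fixes F :: "'b set" and x :: "'i \<Rightarrow> nat \<Rightarrow> nat \<Rightarrow> 'b"
  assumes R: "subspace R" "\<And>x y. x \<in> R \<Longrightarrow> y \<in> R \<Longrightarrow> x * y \<in> R"
    and J: "subspace J" "J \<subseteq> R" "\<And>x y. x \<in> R \<Longrightarrow> y \<in> J \<Longrightarrow> x * y \<in> J"
      "\<And>x y. x \<in> J \<Longrightarrow> y \<in> R \<Longrightarrow> x * y \<in> J"
    and locJ: "\<And>X. finite X \<Longrightarrow> X \<subseteq> J \<Longrightarrow>
      \<exists>(I::nat set) (N::nat \<Rightarrow> nat set) E. matrix_units I N E \<and> unit_set I N E \<subseteq> J \<and>
        X \<subseteq> span (unit_set I N E)"
    and F: "finite F" "F \<subseteq> R"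
    and I: "finite I" "\<And>i. i \<in> I \<Longrightarrow> finite (N i)" "\<And>i. i \<in> I \<Longrightarrow> N i \<noteq> {}"
    and xR: "\<And>i r s. i \<in> I \<Longrightarrow> r \<in> N i \<Longrightarrow> s \<in> N i \<Longrightarrow> x i r s \<in> R"
    and x_nonzero: "\<And>i r. i \<in> I \<Longrightarrow> r \<in> N i \<Longrightarrow> x i r r \<notin> J"
    and x_mult: "\<And>i r s j t u. i \<in> I \<Longrightarrow> r \<in> N i \<Longrightarrow> s \<in> N i \<Longrightarrow> j \<in> I \<Longrightarrow> t \<in> N j \<Longrightarrow> u \<in> N j \<Longrightarrow>
      x i r s * x j t u - (if i = j \<and> s = t then x i r u else 0) \<in> J"
    and Fx: "\<And>f. f \<in> F \<Longrightarrow> \<exists>g\<in>span (unit_set I N x). f - g \<in> J"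
  shows "\<exists>(I'::('i + nat) set) (N'::'i + nat \<Rightarrow> nat set) E'.
    matrix_units I' N' E' \<and> unit_set I' N' E' \<subseteq> R \<and> F \<subseteq> span (unit_set I' N' E')"
proof -
  have reg: "\<exists>z\<in>J. y * z * y = y" if y: "y \<in> J" for y
  proof -
    obtain I :: "nat set" and N :: "nat \<Rightarrow> nat set" and E where E: "matrix_units I N E"
      "unit_set I N E \<subseteq> J" "y \<in> span (unit_set I N E)"
      using locJ[of "{y}"] y by auto
    interpret T: unit_algebra scale I N E
      using E(1) type_algebra_axioms by (simp add: unit_algebra_def)
    have "span (unit_set I N E) \<subseteq> J" using E(2) J(1) by (rule span_minimal)
    then show ?thesis using T.regular_element[OF E(3)] by blast
  qed
  interpret regular_ideal R J
  proof
    show "regular_ring J"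
      unfolding regular_ring_def using reg J
      by (auto simp: subspace_0 subspace_add subspace_diff subsetD)
  qed (use R J in \<open>auto simp: subspace_0 subspace_add subspace_diff\<close>)

  have x_cong: "x i r s * x i s u \<approx> x i r u" if "i \<in> I" "r \<in> N i" "s \<in> N i" "u \<in> N i" for i r s u
    using x_mult[of i r s i s u] that by (simp add: cong_def)
  have "\<exists>e. \<forall>p\<in>Sigma I N. e p \<in> R \<and> e p \<approx> (\<lambda>(i, r). x i r r) p \<and>
      (\<forall>q\<in>Sigma I N. e p * e q = (if p = q then e p else 0))"
  proof (rule lift_orthogonal_idempotents)
    show "finite (Sigma I N)" using I by blast
    show "(\<lambda>(i, r). x i r r) p \<in> R" if "p \<in> Sigma I N" for p using that xR by auto
    fix p q assume pq: "p \<in> Sigma I N" "q \<in> Sigma I N"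
    obtain i r j s where p: "p = (i, r)" and q: "q = (j, s)" by (cases p, cases q)
    have "x i r r * x j s s - (if i = j \<and> r = s then x i r s else 0) \<in> J"
      using pq p q by (intro x_mult) auto
    then show "(\<lambda>(i, r). x i r r) p * (\<lambda>(i, r). x i r r) q \<approx> (if p = q then (\<lambda>(i, r). x i r r) p else 0)"
      by (auto simp: p q cong_def split: if_splits)
  qed
  then obtain e where "\<forall>p\<in>Sigma I N. e p \<in> R \<and> e p \<approx> (\<lambda>(i, r). x i r r) p \<and>
      (\<forall>q\<in>Sigma I N. e p * e q = (if p = q then e p else 0))" ..
  then have eR: "\<And>i r. i \<in> I \<Longrightarrow> r \<in> N i \<Longrightarrow> e (i, r) \<in> R"
    and e_cong: "\<And>i r. i \<in> I \<Longrightarrow> r \<in> N i \<Longrightarrow> e (i, r) \<approx> x i r r"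
    and e_mult: "\<And>i r j s. i \<in> I \<Longrightarrow> r \<in> N i \<Longrightarrow> j \<in> I \<Longrightarrow> s \<in> N j \<Longrightarrow>
      e (i, r) * e (j, s) = (if i = j \<and> r = s then e (i, r) else 0)"
    by auto

  \<comment> \<open>A base index for each block, available because blocks are nonempty. All units of
    a block are routed through the corner at this index, so a single correction per block repairs
    them all.\<close>
  define ob where "ob i = (SOME r. r \<in> N i)" for i
  have ob: "ob i \<in> N i" if "i \<in> I" for i
    unfolding ob_def using I(3)[OF that] by (meson ex_in_conv someI_ex)
  define d where "d i = e (i, ob i)" for i
  \<comment> \<open>Compressing the representatives between exactly orthogonal idempotents makes
    \<open>a i r * b j s\<close> vanish exactly for different index pairs. The defect that remains
    is the difference \<open>k i r\<close> between \<open>d i\<close> and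
    \<open>a i r * b i r\<close>.\<close>
  define a where "a i r = d i * x i (ob i) r * e (i, r)" for i r
  define b where "b i r = e (i, r) * x i r (ob i) * d i" for i r
  have dR: "d i \<in> R" and dd: "d i * d i = d i" if "i \<in> I" for i
    using that ob eR by (simp_all add: d_def e_mult)
  have aR: "a i r \<in> R" and bR: "b i r \<in> R" if "i \<in> I" "r \<in> N i" for i r
    using that ob dR eR xR by (simp_all add: a_def b_def R_closed)
  have da: "d i * a i r = a i r" and bd: "b i r * d i = b i r" and
    ae: "a i r * e (i, r) = a i r" and eb: "e (i, r) * b i r = b i r" if "i \<in> I" "r \<in> N i" for i r
    using that by (simp_all add: a_def b_def mult.assoc dd e_mult)
      (simp_all add: mult.assoc[symmetric] dd e_mult)
  have a_cong: "a i r \<approx> x i (ob i) r" if i: "i \<in> I" and r: "r \<in> N i" for i r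
  proof -
    note o = ob[OF i]
    have 1: "d i * x i (ob i) r \<approx> x i (ob i) r"
      by (rule cong_mult2[OF e_cong[OF i o, folded d_def] cong_refl _ _ x_cong]) (use i r o xR in auto)
    show ?thesis unfolding a_def
      by (rule cong_mult2[OF 1 e_cong[OF i r] _ _ x_cong]) (use i r o xR eR in auto)
  qed
  have b_cong: "b i r \<approx> x i r (ob i)" if i: "i \<in> I" and r: "r \<in> N i" for i r
  proof -
    note o = ob[OF i]
    have 1: "e (i, r) * x i r (ob i) \<approx> x i r (ob i)"
      by (rule cong_mult2[OF e_cong[OF i r] cong_refl _ _ x_cong]) (use i r o xR in auto)
    show ?thesis unfolding b_def
      by (rule cong_mult2[OF 1 e_cong[OF i o, folded d_def] _ _ x_cong]) (use i r o xR dR in auto)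
  qed
  have ab_cong: "a i r * b i r \<approx> d i" if i: "i \<in> I" and r: "r \<in> N i" for i r
  proof -
    have "a i r * b i r \<approx> x i (ob i) (ob i)"
      by (rule cong_mult2[OF a_cong[OF i r] b_cong[OF i r] _ _ x_cong]) (use i r ob xR bR in auto)
    also have "\<dots> \<approx> d i" using cong_sym[OF e_cong[OF i ob[OF i]]] by (simp add: d_def)
    finally show ?thesis .
  qed
  have ba_cong: "b i r * a i s \<approx> x i r s" if i: "i \<in> I" and r: "r \<in> N i" "s \<in> N i" for i r s
    by (rule cong_mult2[OF b_cong[OF i r(1)] a_cong[OF i r(2)] _ _ x_cong]) (use i r ob xR aR in auto)
  have ab_orth: "a i r * b j s = 0"
    if "i \<in> I" "r \<in> N i" "j \<in> I" "s \<in> N j" "\<not> (i = j \<and> r = s)" for i r j s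
  proof -
    have "a i r * b j s = a i r * (e (i, r) * e (j, s)) * b j s"
      by (metis ae eb mult.assoc that(1-4))
    then show ?thesis using that by (simp add: e_mult)
  qed
  define k where "k i r = d i - a i r * b i r" for i r
  have kJ: "k i r \<in> J" and dk: "d i * k i r = k i r" and kd: "k i r * d i = k i r"
    if "i \<in> I" "r \<in> N i" for i r
  proof -
    show "k i r \<in> J" using cong_sym[OF ab_cong[OF that]] by (simp add: k_def cong_def)
    show "d i * k i r = k i r" "k i r * d i = k i r"
      using dd[OF that(1)] da[OF that] bd[OF that]
      by (simp_all add: k_def right_diff_distrib left_diff_distrib mult.assoc)
        (simp_all add: mult.assoc[symmetric])
  qed

  \<comment> \<open>The products \<open>b i r * a i s\<close> are congruent to the representatives
    but not yet matrix units. Approximating \<open>F\<close> by them first avoids a circle: the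
    correction \<open>h\<close> has to absorb the errors \<open>f - G f\<close>, while the final
    units depend on \<open>h\<close>.\<close>
  let ?B = "unit_set I N (\<lambda>i r s. b i r * a i s)"
  have lift: "\<exists>g'\<in>span ?B. g - g' \<in> J" if "g \<in> span (unit_set I N x)" for g
    using that
  proof (induction rule: span_induct)
    show "subspace {g. \<exists>g'\<in>span ?B. g - g' \<in> J}"
      unfolding subspace_def
    proof (intro conjI ballI allI CollectI)
      show "\<exists>g'\<in>span ?B. 0 - g' \<in> J" by (intro bexI[of _ 0]) (auto simp: J_closed span_zero)
      fix g1 assume "g1 \<in> {g. \<exists>g'\<in>span ?B. g - g' \<in> J}"
      then obtain g1' where g1: "g1' \<in> span ?B" "g1 - g1' \<in> J" by blast
      have "c *s g1 - c *s g1' \<in> J" for c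
        using subspace_scale[OF J(1) g1(2)] by (simp add: scale_right_diff_distrib)
      then show "\<exists>g'\<in>span ?B. c *s g1 - g' \<in> J" for c using g1 span_scale by blast
      fix g2 assume "g2 \<in> {g. \<exists>g'\<in>span ?B. g - g' \<in> J}"
      then obtain g2' where g2: "g2' \<in> span ?B" "g2 - g2' \<in> J" by blast
      have "g1 + g2 - (g1' + g2') \<in> J" using cong_add g1 g2 by (simp add: cong_def)
      then show "\<exists>g'\<in>span ?B. g1 + g2 - g' \<in> J" using g1 g2 span_add by blast
    qed
    fix y assume "y \<in> unit_set I N x"
    then obtain i r s where y: "i \<in> I" "r \<in> N i" "s \<in> N i" "y = x i r s" by (elim unit_setE)
    then have "b i r * a i s \<in> span ?B" by (intro span_base) (auto simp: unit_set_def)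
    moreover have "y - b i r * a i s \<in> J"
      using cong_sym[OF ba_cong] y by (simp add: cong_def)
    ultimately show "\<exists>g'\<in>span ?B. y - g' \<in> J" by blast
  qed
  have "\<exists>g\<in>span ?B. f - g \<in> J" if f: "f \<in> F" for f
  proof -
    obtain g where g: "g \<in> span (unit_set I N x)" "f - g \<in> J" using Fx f by blast
    obtain g' where "g' \<in> span ?B" "g - g' \<in> J" using lift g by blast
    then show ?thesis using g cong_trans[of f g g'] by (auto simp: cong_def)
  qed
  then have "\<forall>f\<in>F. \<exists>g. g \<in> span ?B \<and> f - g \<in> J" by (simp add: Bex_def)
  then obtain G where "\<forall>f\<in>F. G f \<in> span ?B \<and> f - G f \<in> J" by (rule bchoice[THEN exE])
  then have G: "\<And>f. f \<in> F \<Longrightarrow> G f \<in> span ?B" "\<And>f. f \<in> F \<Longrightarrow> f - G f \<in> J" by simp_all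

  \<comment> \<open>The defects \<open>k i r\<close> lie in the corner of \<open>d i\<close>, but
    the errors multiplied by \<open>a i r\<close> or \<open>b i r\<close> are fixed by
    \<open>d i\<close> on one side only; hence the separate sets of left and right
    conditions.\<close>
  have "\<exists>h\<in>J. h * h = h \<and> d i * h = h \<and> h * d i = h \<and>
      (\<forall>y\<in>k i ` N i \<union> (\<lambda>(r, f). a i r * (f - G f)) ` (N i \<times> F). h * y = y) \<and>
      (\<forall>y\<in>k i ` N i \<union> (\<lambda>(r, f). (f - G f) * b i r) ` (N i \<times> F). y * h = y)"
    if i: "i \<in> I" for i
  proof (rule corner_local_unit)
    show "d i \<in> R" "d i * d i = d i" using dR dd i by auto
    show "finite (k i ` N i \<union> (\<lambda>(r, f). a i r * (f - G f)) ` (N i \<times> F))"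
      "finite (k i ` N i \<union> (\<lambda>(r, f). (f - G f) * b i r) ` (N i \<times> F))"
      using I F i by auto
    show "k i ` N i \<union> (\<lambda>(r, f). a i r * (f - G f)) ` (N i \<times> F) \<subseteq> J"
      "k i ` N i \<union> (\<lambda>(r, f). (f - G f) * b i r) ` (N i \<times> F) \<subseteq> J"
      using i kJ G(2) aR bR by (auto simp: J_left J_right)
    show "d i * y = y" if "y \<in> k i ` N i \<union> (\<lambda>(r, f). a i r * (f - G f)) ` (N i \<times> F)" for y
      using that i dk da by (auto simp: mult.assoc[symmetric])
    show "y * d i = y" if "y \<in> k i ` N i \<union> (\<lambda>(r, f). (f - G f) * b i r) ` (N i \<times> F)" for y
      using that i kd bd by (auto simp: mult.assoc)
  qed
  then have "\<forall>i\<in>I. \<exists>h. h \<in> J \<and> h * h = h \<and> d i * h = h \<and> h * d i = h \<and>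
      (\<forall>y\<in>k i ` N i \<union> (\<lambda>(r, f). a i r * (f - G f)) ` (N i \<times> F). h * y = y) \<and>
      (\<forall>y\<in>k i ` N i \<union> (\<lambda>(r, f). (f - G f) * b i r) ` (N i \<times> F). y * h = y)"
    by (simp add: Bex_def)
  then obtain h where h: "\<forall>i\<in>I. h i \<in> J \<and> h i * h i = h i \<and> d i * h i = h i \<and> h i * d i = h i \<and>
      (\<forall>y\<in>k i ` N i \<union> (\<lambda>(r, f). a i r * (f - G f)) ` (N i \<times> F). h i * y = y) \<and>
      (\<forall>y\<in>k i ` N i \<union> (\<lambda>(r, f). (f - G f) * b i r) ` (N i \<times> F). y * h i = y)"
    by (rule bchoice[THEN exE])
  have hJ: "h i \<in> J" and hh: "h i * h i = h i" and dh: "d i * h i = h i" and hd: "h i * d i = h i"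
    if "i \<in> I" for i using h that by simp_all
  have hk: "h i * k i r = k i r" and kh: "k i r * h i = k i r" if "i \<in> I" "r \<in> N i" for i r
    using h that by auto
  have ha: "h i * (a i r * (f - G f)) = a i r * (f - G f)"
    and bh: "(f - G f) * b i r * h i = (f - G f) * b i r" if "i \<in> I" "r \<in> N i" "f \<in> F" for i r f
    using h[THEN bspec, OF that(1)] that by (simp_all add: ball_Un split_paired_Ball_Sigma)

  \<comment> \<open>\<open>p i\<close> annihilates every \<open>k i r\<close> on both sides, so
    \<open>a i r * b i r\<close> acts on it exactly like \<open>d i\<close>. It is still congruent
    to \<open>d i\<close> modulo \<open>J\<close>, so the corrected units keep their classes and do
    not vanish.\<close>
  define p where "p i = d i - h i" for i
  have pR: "p i \<in> R" and pp: "p i * p i = p i" and dp: "d i * p i = p i" and pd: "p i * d i = p i"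
    if "i \<in> I" for i
    using that hJ[OF that] by (simp_all add: p_def R_closed dR J_in_R algebra_simps hh dh hd dd)
  have pk: "p i * k i r = 0" and kp: "k i r * p i = 0" if "i \<in> I" "r \<in> N i" for i r
    using hk[OF that] kh[OF that] dk[OF that] kd[OF that]
    by (simp_all add: p_def left_diff_distrib right_diff_distrib)
  have abp: "a i r * (b j s * p j) = (if i = j \<and> r = s then p j else 0)"
    if "i \<in> I" "r \<in> N i" "j \<in> I" "s \<in> N j" for i r j s
  proof (cases "i = j \<and> r = s")
    case True
    have "a i r * (b j s * p j) = (d i - k i r) * p i" using True by (simp add: k_def mult.assoc)
    then show ?thesis using True that by (simp add: left_diff_distrib kp dp)
  next
    case False
    then show ?thesis using ab_orth[OF that False] by (auto simp: mult.assoc[symmetric])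
  qed
  have pab: "p i * a i r * b j s = (if i = j \<and> r = s then p j else 0)"
    if "i \<in> I" "r \<in> N i" "j \<in> I" "s \<in> N j" for i r j s
  proof (cases "i = j \<and> r = s")
    case True
    have "p i * a i r * b j s = p i * (d i - k i r)" using True by (simp add: k_def mult.assoc)
    then show ?thesis using True that by (simp add: right_diff_distrib pk pd)
  next
    case False
    then show ?thesis using ab_orth[OF that False] by (auto simp: mult.assoc)
  qed

  define E where "E i r s = b i r * p i * a i s" for i r s
  have ER: "E i r s \<in> R" if "i \<in> I" "r \<in> N i" "s \<in> N i" for i r s
    using that by (simp add: E_def R_closed aR bR pR)
  have E_cong: "b i r * a i s - E i r s \<in> J" if "i \<in> I" "r \<in> N i" "s \<in> N i" for i r s
  proof -
    have "b i r * a i s - E i r s = b i r * h i * a i s"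
      using bd[OF that(1,2)] by (simp add: E_def p_def left_diff_distrib right_diff_distrib)
    then show ?thesis using that hJ aR bR by (simp add: J_left J_right)
  qed
  have mu: "matrix_units I N E"
  proof
    show "E i r r \<noteq> 0" if "i \<in> I" "r \<in> N i" for i r
    proof
      assume "E i r r = 0"
      then have "0 \<approx> b i r * a i r" using cong_sym[of "b i r * a i r" 0] E_cong[of i r r] that
        by (simp add: cong_def)
      also have "\<dots> \<approx> x i r r" using ba_cong that by simp
      finally have "x i r r \<approx> 0" by (rule cong_sym)
      then show False using x_nonzero that by (simp add: cong_0)
    qed
    fix i r s j t u
    assume A: "i \<in> I" "r \<in> N i" "s \<in> N i" "j \<in> I" "t \<in> N j" "u \<in> N j"
    have "E i r s * E j t u = b i r * p i * (a i s * (b j t * p j)) * a j u"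
      by (simp add: E_def mult.assoc)
    also have "\<dots> = (if i = j \<and> s = t then E i r u else 0)"
      using A by (simp add: abp mult.assoc E_def) (simp add: mult.assoc[symmetric] pp)
    finally show "E i r s * E j t u = (if i = j \<and> s = t then E i r u else 0)" .
  qed (use I in auto)
  interpret U: unit_algebra scale I N E
    using mu type_algebra_axioms by (simp add: unit_algebra_def)

  \<comment> \<open>Annihilation is imposed against the factors \<open>b i s * p i\<close> and
    \<open>p i * a i s\<close> of the units; annihilation by every unit, and hence by their sum
    \<open>U.one\<close>, follows.\<close>
  define orth where "orth y \<longleftrightarrow> y \<in> J \<and> (\<forall>i\<in>I. \<forall>s\<in>N i. y * (b i s * p i) = 0 \<and> p i * a i s * y = 0)" for y
  have orth_add: "orth (y + z)" if "orth y" "orth z" for y z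
    using that by (simp add: orth_def J_closed distrib_left distrib_right)
  have orth_scale: "orth (c *s y)" if "orth y" for c y
    using that subspace_scale[OF J(1)] by (simp add: orth_def scale_mult_left scale_mult_right)
  \<comment> \<open>Replacing \<open>b j r * a j t\<close> by \<open>E j r t\<close> leaves an
    orthogonal error: for the matching index the product with \<open>b j t * p j\<close> is b p - b
    p p = 0, and for the others both terms vanish. The left side is symmetric.\<close>
  have shrink: "\<exists>g'\<in>U.\<A>. orth (g - g')" if "g \<in> span ?B" for g
    using that
  proof (induction rule: span_induct)
    show "subspace {g. \<exists>g'\<in>U.\<A>. orth (g - g')}"
      unfolding subspace_def
    proof (intro conjI ballI allI CollectI)
      show "\<exists>g'\<in>U.\<A>. orth (0 - g')"
        by (intro bexI[of _ 0]) (auto simp: orth_def J_closed span_zero)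
      fix g1 assume "g1 \<in> {g. \<exists>g'\<in>U.\<A>. orth (g - g')}"
      then obtain g1' where g1: "g1' \<in> U.\<A>" "orth (g1 - g1')" by blast
      have "orth (c *s g1 - c *s g1')" for c
        using orth_scale[OF g1(2)] by (simp add: scale_right_diff_distrib)
      then show "\<exists>g'\<in>U.\<A>. orth (c *s g1 - g')" for c using g1 span_scale by blast
      fix g2 assume "g2 \<in> {g. \<exists>g'\<in>U.\<A>. orth (g - g')}"
      then obtain g2' where g2: "g2' \<in> U.\<A>" "orth (g2 - g2')" by blast
      have "orth (g1 + g2 - (g1' + g2'))"
        using orth_add[OF g1(2) g2(2)] by (simp add: algebra_simps)
      then show "\<exists>g'\<in>U.\<A>. orth (g1 + g2 - g')" using g1 g2 span_add by blast
    qed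
    fix y assume "y \<in> ?B"
    then obtain j r t where y: "j \<in> I" "r \<in> N j" "t \<in> N j" "y = b j r * a j t"
      by (elim unit_setE)
    have "orth (y - E j r t)"
      unfolding orth_def
    proof (intro conjI ballI)
      show "y - E j r t \<in> J" using E_cong y by simp
      fix i s assume i: "i \<in> I" "s \<in> N i"
      have "(y - E j r t) * (b i s * p i) =
          b j r * (a j t * (b i s * p i)) - b j r * p j * (a j t * (b i s * p i))"
        by (simp add: y E_def left_diff_distrib mult.assoc)
      also have "\<dots> = 0" using y i by (simp add: abp mult.assoc pp)
      finally show "(y - E j r t) * (b i s * p i) = 0" .
      have "p i * a i s * (y - E j r t) =
          (p i * a i s * b j r) * a j t - (p i * a i s * b j r) * p j * a j t"
        by (simp add: y E_def right_diff_distrib mult.assoc)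
      also have "\<dots> = 0" using y i by (simp add: pab pp)
      finally show "p i * a i s * (y - E j r t) = 0" .
    qed
    then show "\<exists>g'\<in>U.\<A>. orth (y - g')" using U.unit_in y by blast
  qed
  have "\<exists>g'\<in>U.\<A>. orth (f - g')" if f: "f \<in> F" for f
  proof -
    obtain g' where g': "g' \<in> U.\<A>" "orth (G f - g')" using shrink G(1)[OF f] by blast
    have "orth (f - G f)"
      unfolding orth_def
    proof (intro conjI ballI)
      show "f - G f \<in> J" using G(2) f .
      fix i s assume i: "i \<in> I" "s \<in> N i"
      have "(f - G f) * (b i s * p i) = (f - G f) * (b i s * d i) - (f - G f) * b i s * h i"
        by (simp add: p_def right_diff_distrib mult.assoc)
      then show "(f - G f) * (b i s * p i) = 0" using bd[OF i] bh[OF i f] by simp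
      have "p i * a i s * (f - G f) = (d i * a i s) * (f - G f) - h i * (a i s * (f - G f))"
        by (simp add: p_def left_diff_distrib mult.assoc)
      then show "p i * a i s * (f - G f) = 0" using da[OF i] ha[OF i f] by simp
    qed
    then have "orth (f - g')" using orth_add[of "f - G f" "G f - g'"] g' by simp
    then show ?thesis using g' by blast
  qed
  then have "\<forall>f\<in>F. \<exists>g. g \<in> U.\<A> \<and> orth (f - g)" by (simp add: Bex_def)
  then obtain H where "\<forall>f\<in>F. H f \<in> U.\<A> \<and> orth (f - H f)" by (rule bchoice[THEN exE])
  then have H: "\<And>f. f \<in> F \<Longrightarrow> H f \<in> U.\<A>" "\<And>f. f \<in> F \<Longrightarrow> orth (f - H f)" by simp_all
  have oneR: "U.one \<in> R" unfolding U.one_def by (rule R_sum) (auto simp: ER)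
  let ?C = "{y \<in> J. U.one * y = 0 \<and> y * U.one = 0}"
  have orth_one: "y \<in> ?C" if "orth y" for y
  proof -
    have "b i s * p i * a i s * y = 0" if "i \<in> I" "s \<in> N i" for i s
    proof -
      have "b i s * p i * a i s * y = b i s * (p i * a i s * y)" by (simp add: mult.assoc)
      then show ?thesis using \<open>orth y\<close> that by (simp add: orth_def)
    qed
    then have 1: "U.one * y = 0"
      unfolding U.one_def sum_distrib_right by (intro sum.neutral) (auto simp: E_def)
    have "y * (b i s * p i * a i s) = 0" if "i \<in> I" "s \<in> N i" for i s
    proof -
      have "y * (b i s * p i * a i s) = y * (b i s * p i) * a i s" by (simp add: mult.assoc)
      then show ?thesis using \<open>orth y\<close> that by (simp add: orth_def)
    qed
    then have "y * U.one = 0"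
      unfolding U.one_def sum_distrib_left by (intro sum.neutral) (auto simp: E_def)
    with 1 show ?thesis using that by (simp add: orth_def)
  qed
  \<comment> \<open>Taking the local unit inside the annihilator of \<open>U.one\<close>, and not
    merely in \<open>J\<close>, is what separates the two systems of matrix units.\<close>
  have "\<exists>q\<in>?C. q * q = q \<and> (\<forall>y\<in>(\<lambda>f. f - H f) ` F. q * y = y \<and> y * q = y)"
    using F(1) H(2) orth_one
    by (intro regular_ring_local_unit regular_annihilator oneR U.one_one) auto
  then obtain q where q: "q \<in> J" "U.one * q = 0" "q * U.one = 0" "q * q = q"
    and qf: "\<And>f. f \<in> F \<Longrightarrow> q * (f - H f) = f - H f" "\<And>f. f \<in> F \<Longrightarrow> (f - H f) * q = f - H f"
    by auto
  \<comment> \<open>\<open>q\<close> joins the finite set so that it lies in the matricial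
    subalgebra obtained from \<open>J\<close>. That subalgebra need not be orthogonal to
    \<open>U.one\<close>; its corner at \<open>q\<close> is.\<close>
  have "insert q ((\<lambda>f. f - H f) ` F) \<subseteq> J" using q H(2) by (auto simp: orth_def)
  then obtain I2 :: "nat set" and N2 :: "nat \<Rightarrow> nat set" and E2 where E2: "matrix_units I2 N2 E2"
    "unit_set I2 N2 E2 \<subseteq> J" "insert q ((\<lambda>f. f - H f) ` F) \<subseteq> span (unit_set I2 N2 E2)"
    using locJ[of "insert q ((\<lambda>f. f - H f) ` F)"] F(1) by auto
  interpret T: unit_algebra scale I2 N2 E2
    using E2(1) type_algebra_axioms by (simp add: unit_algebra_def)
  have TJ: "T.\<A> \<subseteq> J" using E2(2) J(1) by (rule span_minimal)
  have qT: "q \<in> T.\<A>" using E2(3) by simp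
  from T.corner_matrix_units[OF qT q(4)] obtain N3 :: "nat \<Rightarrow> nat set" and E3 where E3: "matrix_units I2 N3 E3" "unit_set I2 N3 E3 \<subseteq> T.\<A>"
    "\<And>y. y \<in> unit_set I2 N3 E3 \<Longrightarrow> q * y = y \<and> y * q = y"
    "\<And>y. y \<in> T.\<A> \<Longrightarrow> q * y * q \<in> span (unit_set I2 N3 E3)"
    by (elim exE conjE) (simp only: Ball_def)
  interpret V: unit_algebra scale I2 N3 E3
    using E3(1) type_algebra_axioms by (simp add: unit_algebra_def)
  have cross: "E i r s * E3 j t u = 0" "E3 j t u * E i r s = 0"
    if A: "i \<in> I" "r \<in> N i" "s \<in> N i" "j \<in> I2" "t \<in> N3 j" "u \<in> N3 j" for i r s j t u
  proof -
    have 1: "q * E3 j t u = E3 j t u" "E3 j t u * q = E3 j t u"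
      using E3(3)[OF unit_setI] A by auto
    have 2: "U.one * E i r s = E i r s" "E i r s * U.one = E i r s" using U.one_mult_unit A by auto
    have "E i r s * E3 j t u = E i r s * (U.one * q) * E3 j t u"
      using 1(1) 2(2) by (metis mult.assoc)
    then show "E i r s * E3 j t u = 0" using q by simp
    have "E3 j t u * E i r s = E3 j t u * (q * U.one) * E i r s"
      using 1(2) 2(1) by (metis mult.assoc)
    then show "E3 j t u * E i r s = 0" using q by simp
  qed
  let ?I = "I <+> I2" and ?N = "case_sum N N3" and ?E = "case_sum E E3"
  have "matrix_units ?I ?N ?E"
  proof
    show "finite ?I" using I(1) V.finite_I by simp
    show "finite (?N i)" if "i \<in> ?I" for i using that I(2) V.finite_N by auto
    show "?E i r r \<noteq> 0" if "i \<in> ?I" "r \<in> ?N i" for i r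
      using that U.unit_nonzero V.unit_nonzero by auto
    show "?E i r s * ?E j t u = (if i = j \<and> s = t then ?E i r u else 0)"
      if "i \<in> ?I" "r \<in> ?N i" "s \<in> ?N i" "j \<in> ?I" "t \<in> ?N j" "u \<in> ?N j" for i r s j t u
      using that by (auto simp: U.unit_mult V.unit_mult cross split: if_splits)
  qed
  moreover have sub: "unit_set I N E \<subseteq> unit_set ?I ?N ?E" "unit_set I2 N3 E3 \<subseteq> unit_set ?I ?N ?E"
  proof -
    have "?E (Inl i) r s \<in> unit_set ?I ?N ?E" if "i \<in> I" "r \<in> N i" "s \<in> N i" for i r s
      using that by (intro unit_setI) auto
    moreover have "?E (Inr i) r s \<in> unit_set ?I ?N ?E" if "i \<in> I2" "r \<in> N3 i" "s \<in> N3 i" for i r s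
      using that by (intro unit_setI) auto
    ultimately show "unit_set I N E \<subseteq> unit_set ?I ?N ?E" "unit_set I2 N3 E3 \<subseteq> unit_set ?I ?N ?E"
      by (auto elim!: unit_setE)
  qed
  moreover have "unit_set ?I ?N ?E \<subseteq> R"
  proof
    fix y assume "y \<in> unit_set ?I ?N ?E"
    then obtain i r s where y: "i \<in> ?I" "r \<in> ?N i" "s \<in> ?N i" "y = ?E i r s" by (elim unit_setE)
    show "y \<in> R"
    proof (cases i)
      case (Inl j)
      then show ?thesis using y ER by auto
    next
      case (Inr j)
      then have "y \<in> unit_set I2 N3 E3" using y by (auto intro: unit_setI)
      then show ?thesis using E3(2) TJ J(2) by blast
    qed
  qed
  moreover have "F \<subseteq> span (unit_set ?I ?N ?E)"
  proof
    fix f assume f: "f \<in> F"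
    have "f - H f \<in> T.\<A>" using E2(3) f by auto
    then have "q * (f - H f) * q \<in> V.\<A>" by (rule E3(4))
    then have "f - H f \<in> V.\<A>" using qf[OF f] by simp
    then have "H f + (f - H f) \<in> span (unit_set ?I ?N ?E)"
      using H(1)[OF f] span_mono[OF sub(1)] span_mono[OF sub(2)] by (intro span_add) blast+
    then show "f \<in> span (unit_set ?I ?N ?E)" by simp
  qed
  ultimately show ?thesis by blast
qed

section \<open>Embedding algebras into a ring type\<close>

lemma kalgebra_facts:
  assumes "kalgebra A"
  shows "azero A \<in> acarrier A"
    and "x \<in> acarrier A \<Longrightarrow> y \<in> acarrier A \<Longrightarrow> aadd A x y \<in> acarrier A"
    and "x \<in> acarrier A \<Longrightarrow> y \<in> acarrier A \<Longrightarrow> amul A x y \<in> acarrier A"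
    and "x \<in> acarrier A \<Longrightarrow> asmul A a x \<in> acarrier A"
    and "x \<in> acarrier A \<Longrightarrow> y \<in> acarrier A \<Longrightarrow> z \<in> acarrier A \<Longrightarrow>
      aadd A (aadd A x y) z = aadd A x (aadd A y z)"
    and "x \<in> acarrier A \<Longrightarrow> y \<in> acarrier A \<Longrightarrow> aadd A x y = aadd A y x"
    and "x \<in> acarrier A \<Longrightarrow> aadd A (azero A) x = x"
    and "x \<in> acarrier A \<Longrightarrow> \<exists>y\<in>acarrier A. aadd A x y = azero A"
    and "x \<in> acarrier A \<Longrightarrow> y \<in> acarrier A \<Longrightarrow> z \<in> acarrier A \<Longrightarrow>
      amul A (amul A x y) z = amul A x (amul A y z)"
    and "x \<in> acarrier A \<Longrightarrow> y \<in> acarrier A \<Longrightarrow> z \<in> acarrier A \<Longrightarrow>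
      amul A x (aadd A y z) = aadd A (amul A x y) (amul A x z)"
    and "x \<in> acarrier A \<Longrightarrow> y \<in> acarrier A \<Longrightarrow> z \<in> acarrier A \<Longrightarrow>
      amul A (aadd A x y) z = aadd A (amul A x z) (amul A y z)"
    and "x \<in> acarrier A \<Longrightarrow> y \<in> acarrier A \<Longrightarrow>
      asmul A a (aadd A x y) = aadd A (asmul A a x) (asmul A a y)"
    and "x \<in> acarrier A \<Longrightarrow> asmul A (a + b) x = aadd A (asmul A a x) (asmul A b x)"
    and "x \<in> acarrier A \<Longrightarrow> asmul A (a * b) x = asmul A a (asmul A b x)"
    and "x \<in> acarrier A \<Longrightarrow> asmul A 1 x = x"
    and "x \<in> acarrier A \<Longrightarrow> y \<in> acarrier A \<Longrightarrow> amul A (asmul A a x) y = asmul A a (amul A x y)"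
    and "x \<in> acarrier A \<Longrightarrow> y \<in> acarrier A \<Longrightarrow> amul A x (asmul A a y) = asmul A a (amul A x y)"
  using assms unfolding kalgebra_def by metis+

text \<open>The records carry no subtraction; this criterion takes the place of cancellation in
  deriving the zero laws.\<close>

lemma kalgebra_idempotent_add:
  assumes A: "kalgebra A" and x: "x \<in> acarrier A" "aadd A x x = x"
  shows "x = azero A"
proof -
  obtain y where y: "y \<in> acarrier A" "aadd A x y = azero A" using kalgebra_facts(8)[OF A x(1)] by blast
  have "aadd A x (aadd A x y) = aadd A x y" using kalgebra_facts(5)[OF A x(1) x(1) y(1)] x by simp
  then show ?thesis
    using y kalgebra_facts(6)[OF A x(1) kalgebra_facts(1)[OF A]] kalgebra_facts(7)[OF A x(1)] by simp
qed

lemma kalgebra_zero: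
  assumes A: "kalgebra A"
  shows "x \<in> acarrier A \<Longrightarrow> asmul A 0 x = azero A"
    and "asmul A a (azero A) = azero A"
    and "amul A (azero A) (azero A) = azero A"
proof -
  note K = kalgebra_facts[OF A]
  show "asmul A 0 x = azero A" if "x \<in> acarrier A" for x
    using kalgebra_idempotent_add[OF A K(4)[OF that]] K(13)[OF that, of 0 0] by simp
  show "asmul A a (azero A) = azero A"
    using kalgebra_idempotent_add[OF A K(4)[OF K(1)]] K(12)[OF K(1) K(1)] K(7)[OF K(1)] by simp
  show "amul A (azero A) (azero A) = azero A"
    using kalgebra_idempotent_add[OF A K(3)[OF K(1) K(1)]] K(10)[OF K(1) K(1) K(1)] K(7)[OF K(1)] by simp
qed

lemma kalgebra_neg:
  assumes A: "kalgebra A" and x: "x \<in> acarrier A"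
  shows "aadd A (asmul A (- 1) x) x = azero A"
  using kalgebra_facts(13)[OF A x, of "- 1" 1] kalgebra_facts(15)[OF A x] kalgebra_zero(1)[OF A x] by simp

text \<open>A type cannot depend on a given algebra, so all structures over \<open>'a\<close> are
  collected at once. The one-element algebra shows that the type is inhabited.\<close>

typedef (overloaded) ('k::field, 'a) kalgebras = "{A :: ('k, 'a) kalg. kalgebra A}"
  morphisms structure_of Abs_kalgebras
proof -
  have "kalgebra \<lparr>acarrier = {undefined}, azero = undefined, aadd = (\<lambda>x y. undefined),
    amul = (\<lambda>x y. undefined), asmul = (\<lambda>a x. undefined)\<rparr>"
    by (simp add: kalgebra_def)
  then show ?thesis by blast
qed

lemma kalgebra_structure_of: "kalgebra (structure_of A)"
  using structure_of by simp

text \<open>The product of all algebra structures on subsets of a type is an algebra whose carrier is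
  a whole type, and it contains every one of its factors.\<close>

typedef (overloaded) ('k::field, 'a) big_algebra =
  "{f :: ('k, 'a) kalgebras \<Rightarrow> 'a. \<forall>A. f A \<in> acarrier (structure_of A)}"
  by (rule exI[of _ "\<lambda>A. azero (structure_of A)"]) (simp add: kalgebra_facts(1) kalgebra_structure_of)

setup_lifting type_definition_big_algebra

instantiation big_algebra :: (field, type) ring
begin

lift_definition zero_big_algebra :: "('a, 'b) big_algebra" is "\<lambda>A. azero (structure_of A)"
  by (simp add: kalgebra_facts kalgebra_structure_of)

lift_definition plus_big_algebra :: "('a, 'b) big_algebra \<Rightarrow> ('a, 'b) big_algebra \<Rightarrow> ('a, 'b) big_algebra"
  is "\<lambda>f g A. aadd (structure_of A) (f A) (g A)"
  by (simp add: kalgebra_facts kalgebra_structure_of)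

lift_definition times_big_algebra :: "('a, 'b) big_algebra \<Rightarrow> ('a, 'b) big_algebra \<Rightarrow> ('a, 'b) big_algebra"
  is "\<lambda>f g A. amul (structure_of A) (f A) (g A)"
  by (simp add: kalgebra_facts kalgebra_structure_of)

text \<open>Negation is scaling by \<open>- 1\<close>, since additive inverses are not chosen by the
  records.\<close>

lift_definition uminus_big_algebra :: "('a, 'b) big_algebra \<Rightarrow> ('a, 'b) big_algebra"
  is "\<lambda>f A. asmul (structure_of A) (- 1) (f A)"
  by (simp add: kalgebra_facts kalgebra_structure_of)

definition minus_big_algebra :: "('a, 'b) big_algebra \<Rightarrow> ('a, 'b) big_algebra \<Rightarrow> ('a, 'b) big_algebra"
  where "minus_big_algebra x y = x + - y"

instance
proof
  fix x y z :: "('a, 'b) big_algebra"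
  show "x + y + z = x + (y + z)" by transfer (simp add: kalgebra_facts(2,5) kalgebra_structure_of)
  show "x + y = y + x" by transfer (simp add: kalgebra_facts(6) kalgebra_structure_of)
  show "0 + x = x" by transfer (simp add: kalgebra_facts(7) kalgebra_structure_of)
  show "- x + x = 0" by transfer (simp add: kalgebra_neg kalgebra_structure_of)
  show "x - y = x + - y" by (rule minus_big_algebra_def)
  show "x * y * z = x * (y * z)" by transfer (simp add: kalgebra_facts kalgebra_structure_of)
  show "(x + y) * z = x * z + y * z" by transfer (simp add: kalgebra_facts kalgebra_structure_of)
  show "x * (y + z) = x * y + x * z" by transfer (simp add: kalgebra_facts kalgebra_structure_of)
qed

end

lift_definition big_scale :: "'k::field \<Rightarrow> ('k, 'a) big_algebra \<Rightarrow> ('k, 'a) big_algebra"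
  is "\<lambda>a f A. asmul (structure_of A) a (f A)"
  by (simp add: kalgebra_facts kalgebra_structure_of)

interpretation big: type_algebra "big_scale :: 'k::field \<Rightarrow> ('k, 'a) big_algebra \<Rightarrow> _"
proof
  fix a b :: 'k and x y :: "('k, 'a) big_algebra"
  show "big_scale a (x + y) = big_scale a x + big_scale a y"
    by transfer (simp add: kalgebra_facts kalgebra_structure_of)
  show "big_scale (a + b) x = big_scale a x + big_scale b x"
    by transfer (simp add: kalgebra_facts kalgebra_structure_of)
  show "big_scale a (big_scale b x) = big_scale (a * b) x"
    by transfer (simp add: kalgebra_facts kalgebra_structure_of)
  show "big_scale 1 x = x" by transfer (simp add: kalgebra_facts kalgebra_structure_of)
  show "big_scale a x * y = big_scale a (x * y)"
    by transfer (simp add: kalgebra_facts kalgebra_structure_of)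
  show "x * big_scale a y = big_scale a (x * y)"
    by transfer (simp add: kalgebra_facts kalgebra_structure_of)
qed

locale embedded_algebra = type_algebra scale
  for scale :: "'k::field \<Rightarrow> 'b::ring \<Rightarrow> 'b" (infixr \<open>*s\<close> 75) +
  fixes A :: "('k, 'a) kalg" and \<iota> :: "'a \<Rightarrow> 'b"
  assumes alg: "kalgebra A"
    and inj: "inj_on \<iota> (acarrier A)"
    and hom_add: "x \<in> acarrier A \<Longrightarrow> y \<in> acarrier A \<Longrightarrow> \<iota> (aadd A x y) = \<iota> x + \<iota> y"
    and hom_mul: "x \<in> acarrier A \<Longrightarrow> y \<in> acarrier A \<Longrightarrow> \<iota> (amul A x y) = \<iota> x * \<iota> y"
    and hom_smul: "x \<in> acarrier A \<Longrightarrow> \<iota> (asmul A a x) = a *s \<iota> x"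

text \<open>Padding with zero in all other factors respects every operation, since no unit has to be
  preserved, and projecting to the factor \<open>A\<close> gives injectivity. Outside the carrier
  the values of the map carry no meaning.\<close>

lemma embedding_exists:
  fixes A :: "('k::field, 'a) kalg"
  assumes A: "kalgebra A"
  obtains \<iota> where "embedded_algebra (big_scale :: 'k \<Rightarrow> ('k, 'a) big_algebra \<Rightarrow> _) A \<iota>"
proof -
  define \<iota> where "\<iota> x = Abs_big_algebra (\<lambda>B. if structure_of B = A then x else azero (structure_of B))" for x
  have rep: "Rep_big_algebra (\<iota> x) = (\<lambda>B. if structure_of B = A then x else azero (structure_of B))"
    if "x \<in> acarrier A" for x
    unfolding \<iota>_def using that
    by (intro Abs_big_algebra_inverse) (auto simp: kalgebra_facts(1) kalgebra_structure_of)
  note K = kalgebra_facts[OF A] and Z = kalgebra_facts[OF kalgebra_structure_of]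
    kalgebra_zero[OF kalgebra_structure_of]
  have "embedded_algebra (big_scale :: 'k \<Rightarrow> ('k, 'a) big_algebra \<Rightarrow> _) A \<iota>"
  proof
    show "kalgebra A" by (rule A)
    show "inj_on \<iota> (acarrier A)"
    proof
      fix x y assume xy: "x \<in> acarrier A" "y \<in> acarrier A" "\<iota> x = \<iota> y"
      then have "Rep_big_algebra (\<iota> x) (Abs_kalgebras A) = Rep_big_algebra (\<iota> y) (Abs_kalgebras A)" by simp
      then show "x = y"
        unfolding rep[OF xy(1)] rep[OF xy(2)] using A by (simp add: Abs_kalgebras_inverse)
    qed
    fix x y assume x: "x \<in> acarrier A" and y: "y \<in> acarrier A"
    show "\<iota> (aadd A x y) = \<iota> x + \<iota> y"
      by (rule Rep_big_algebra_inject[THEN iffD1])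
        (auto simp: rep x y K plus_big_algebra.rep_eq Z)
    show "\<iota> (amul A x y) = \<iota> x * \<iota> y"
      by (rule Rep_big_algebra_inject[THEN iffD1])
        (auto simp: rep x y K times_big_algebra.rep_eq Z)
  next
    fix x and a :: 'k assume x: "x \<in> acarrier A"
    show "\<iota> (asmul A a x) = big_scale a (\<iota> x)"
      by (rule Rep_big_algebra_inject[THEN iffD1])
        (auto simp: rep x K big_scale.rep_eq Z)
  qed
  then show thesis by (rule that)
qed

section \<open>Matricial algebras and matrix units\<close>

definition mat_unit :: "nat \<Rightarrow> nat \<Rightarrow> nat \<Rightarrow> nat \<Rightarrow> nat \<Rightarrow> nat \<Rightarrow> 'k::field" where
  "mat_unit i r s = (\<lambda>i' r' s'. if i' = i \<and> r' = r \<and> s' = s then 1 else 0)"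

lemma matricial_alg_simps [simp]:
  "acarrier (matricial_alg ns) = mat_carrier ns"
  "azero (matricial_alg ns) = (\<lambda>i r c. 0)"
  "aadd (matricial_alg ns) f g = (\<lambda>i r c. f i r c + g i r c)"
  "amul (matricial_alg ns) f g = (\<lambda>i r c. if i < length ns then (\<Sum>j<ns ! i. f i r j * g i j c) else 0)"
  "asmul (matricial_alg ns) a f = (\<lambda>i r c. a * f i r c)"
  by (simp_all add: matricial_alg_def)

lemma mat_carrier_closed:
  "(\<lambda>i r c. 0) \<in> mat_carrier ns"
  "f \<in> mat_carrier ns \<Longrightarrow> g \<in> mat_carrier ns \<Longrightarrow> (\<lambda>i r c. f i r c + g i r c) \<in> mat_carrier ns"
  "f \<in> mat_carrier ns \<Longrightarrow> (\<lambda>i r c. a * f i r c) \<in> mat_carrier ns"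
  "f \<in> mat_carrier ns \<Longrightarrow> g \<in> mat_carrier ns \<Longrightarrow> amul (matricial_alg ns) f g \<in> mat_carrier ns"
  "i < length ns \<Longrightarrow> r < ns ! i \<Longrightarrow> s < ns ! i \<Longrightarrow> mat_unit i r s \<in> mat_carrier ns"
  by (auto simp: mat_carrier_def mat_unit_def)

lemma mat_unit_mult:
  assumes "i < length ns" "s < ns ! i"
  shows "amul (matricial_alg ns) (mat_unit i r s) (mat_unit j t u) =
    (if i = j \<and> s = t then mat_unit i r u else (\<lambda>i r c. 0 :: 'k::field))"
proof (intro ext)
  fix i' r' c'
  have "(\<Sum>k<ns ! i'. mat_unit i r s i' r' k * mat_unit j t u i' k c') =
      (\<Sum>k<ns ! i'. if k = s then mat_unit i r s i' r' s * mat_unit j t u i' s c' else 0 :: 'k)"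
    by (rule sum.cong) (auto simp: mat_unit_def)
  then show "amul (matricial_alg ns) (mat_unit i r s) (mat_unit j t u) i' r' c' =
    (if i = j \<and> s = t then mat_unit i r u else (\<lambda>i r c. 0 :: 'k)) i' r' c'"
    using assms by (auto simp: mat_unit_def)
qed

text \<open>The fact that matrix units span, as an induction rule. It is proved by induction on a
  finite set containing the support, splitting off one position at a time.\<close>

lemma mat_induct [consumes 1, case_names zero add scale unit]:
  fixes m :: "nat \<Rightarrow> nat \<Rightarrow> nat \<Rightarrow> 'k::field"
  assumes m: "m \<in> mat_carrier ns"
    and zero: "P (\<lambda>i r c. 0)"
    and add: "\<And>f g. f \<in> mat_carrier ns \<Longrightarrow> g \<in> mat_carrier ns \<Longrightarrow> P f \<Longrightarrow> P g \<Longrightarrow>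
      P (\<lambda>i r c. f i r c + g i r c)"
    and scale: "\<And>a f. f \<in> mat_carrier ns \<Longrightarrow> P f \<Longrightarrow> P (\<lambda>i r c. a * f i r c)"
    and unit: "\<And>i r s. i < length ns \<Longrightarrow> r < ns ! i \<Longrightarrow> s < ns ! i \<Longrightarrow> P (mat_unit i r s)"
  shows "P m"
proof -
  let ?D = "SIGMA i:{..<length ns}. {..<ns ! i} \<times> {..<ns ! i}"
  have "\<forall>m\<in>mat_carrier ns. (\<forall>i r s. m i r s \<noteq> 0 \<longrightarrow> (i, r, s) \<in> T) \<longrightarrow> P m"
    if "finite T" "T \<subseteq> ?D" for T
    using that
  proof (induction T rule: finite_induct)
    case empty
    show ?case
    proof (intro ballI impI)
      fix m :: "nat \<Rightarrow> nat \<Rightarrow> nat \<Rightarrow> 'k" assume "\<forall>i r s. m i r s \<noteq> 0 \<longrightarrow> (i, r, s) \<in> {}"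
      then have "m = (\<lambda>i r c. 0)" by (intro ext) simp
      then show "P m" using zero by simp
    qed
  next
    case (insert p T)
    obtain i r s where p: "p = (i, r, s)" by (cases p)
    then have irs: "i < length ns" "r < ns ! i" "s < ns ! i" using insert.prems by auto
    show ?case
    proof (intro ballI impI)
      fix m :: "nat \<Rightarrow> nat \<Rightarrow> nat \<Rightarrow> 'k" assume m: "m \<in> mat_carrier ns"
        and supp: "\<forall>i r s. m i r s \<noteq> 0 \<longrightarrow> (i, r, s) \<in> insert p T"
      define f where "f = (\<lambda>i' r' s'. if i' = i \<and> r' = r \<and> s' = s then 0 else m i' r' s')"
      define g where "g = (\<lambda>i' r' s'. m i r s * mat_unit i r s i' r' s')"
      have f: "f \<in> mat_carrier ns" using m by (auto simp: mat_carrier_def f_def)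
      have g: "g \<in> mat_carrier ns" unfolding g_def using irs by (intro mat_carrier_closed)
      have "\<forall>i r s. f i r s \<noteq> 0 \<longrightarrow> (i, r, s) \<in> T" using supp by (auto simp: f_def p)
      then have "P f" using insert.IH insert.prems f by blast
      moreover have "P g" unfolding g_def using irs by (intro scale mat_carrier_closed unit)
      ultimately have "P (\<lambda>i r c. f i r c + g i r c)" using add f g by blast
      also have "(\<lambda>i r c. f i r c + g i r c) = m"
        by (intro ext) (auto simp: f_def g_def mat_unit_def)
      finally show "P m" .
    qed
  qed
  from this[of ?D] have "(\<forall>i r s. m i r s \<noteq> 0 \<longrightarrow> (i, r, s) \<in> ?D) \<longrightarrow> P m" using m by auto
  moreover have "\<forall>i r s. m i r s \<noteq> 0 \<longrightarrow> (i, r, s) \<in> ?D"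
    using m by (auto simp: mat_carrier_def not_le[symmetric])
  ultimately show ?thesis by blast
qed

section \<open>Matrix units from maps that are homomorphisms modulo a subspace\<close>

context type_algebra
begin

text \<open>Working modulo \<open>J\<close> lets one argument serve both hypotheses: with
  \<open>{0}\<close> it covers an embedded matricial subalgebra of the ideal, and with the image of
  the ideal it covers representatives of a matricial subalgebra of the quotient.\<close>

lemma units_modulo:
  fixes \<psi> :: "(nat \<Rightarrow> nat \<Rightarrow> nat \<Rightarrow> 'k) \<Rightarrow> 'b"
  assumes J: "subspace J"
    and add: "\<forall>f\<in>mat_carrier ns. \<forall>g\<in>mat_carrier ns.
      \<psi> (aadd (matricial_alg ns) f g) - (\<psi> f + \<psi> g) \<in> J"
    and mul: "\<forall>f\<in>mat_carrier ns. \<forall>g\<in>mat_carrier ns.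
      \<psi> (amul (matricial_alg ns) f g) - \<psi> f * \<psi> g \<in> J"
    and smul: "\<forall>a. \<forall>f\<in>mat_carrier ns. \<psi> (asmul (matricial_alg ns) a f) - a *s \<psi> f \<in> J"
    and inj: "\<forall>f\<in>mat_carrier ns. \<psi> f \<in> J \<longrightarrow> f = (\<lambda>i r c. 0)"
  shows "i < length ns \<Longrightarrow> r < ns ! i \<Longrightarrow> \<psi> (mat_unit i r r) \<notin> J"
    and "i < length ns \<Longrightarrow> r < ns ! i \<Longrightarrow> s < ns ! i \<Longrightarrow> j < length ns \<Longrightarrow> t < ns ! j \<Longrightarrow> u < ns ! j \<Longrightarrow>
      \<psi> (mat_unit i r s) * \<psi> (mat_unit j t u) -
        (if i = j \<and> s = t then \<psi> (mat_unit i r u) else 0) \<in> J"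
    and "f \<in> mat_carrier ns \<Longrightarrow>
      \<exists>g\<in>span (unit_set {..<length ns} (\<lambda>i. {..<ns ! i}) (\<lambda>i r s. \<psi> (mat_unit i r s))). \<psi> f - g \<in> J"
proof -
  note add = add[rule_format] and mul = mul[rule_format] and smul = smul[rule_format] and inj = inj[rule_format]
  have zero: "\<psi> (\<lambda>i r c. 0) \<in> J"
    using smul[OF mat_carrier_closed(1), of 0] by simp
  show "\<psi> (mat_unit i r r) \<notin> J" if "i < length ns" "r < ns ! i" for i r
  proof
    assume "\<psi> (mat_unit i r r) \<in> J"
    then have "mat_unit i r r = (\<lambda>i r c. 0 :: 'k)" using inj that mat_carrier_closed(5) by blast
    then have "mat_unit i r r i r r = (0 :: 'k)" by simp
    then show False by (simp add: mat_unit_def)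
  qed
  show "\<psi> (mat_unit i r s) * \<psi> (mat_unit j t u) -
      (if i = j \<and> s = t then \<psi> (mat_unit i r u) else 0) \<in> J"
    if "i < length ns" "r < ns ! i" "s < ns ! i" "j < length ns" "t < ns ! j" "u < ns ! j" for i r s j t u
  proof -
    have "\<psi> (amul (matricial_alg ns) (mat_unit i r s) (mat_unit j t u)) -
        \<psi> (mat_unit i r s) * \<psi> (mat_unit j t u) \<in> J"
      using that by (intro mul mat_carrier_closed)
    then have 1: "\<psi> (if i = j \<and> s = t then mat_unit i r u else (\<lambda>i r c. 0)) -
        \<psi> (mat_unit i r s) * \<psi> (mat_unit j t u) \<in> J"
      unfolding mat_unit_mult[OF that(1,3)] .
    show ?thesis
    proof (cases "i = j \<and> s = t")
      case True
      then show ?thesis using subspace_neg[OF J 1] by simp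
    next
      case False
      show ?thesis using subspace_diff[OF J zero 1] unfolding if_not_P[OF False] by simp
    qed
  qed
  let ?S = "span (unit_set {..<length ns} (\<lambda>i. {..<ns ! i}) (\<lambda>i r s. \<psi> (mat_unit i r s)))"
  show "\<exists>g\<in>?S. \<psi> f - g \<in> J" if "f \<in> mat_carrier ns" for f
    using that
  proof (induction rule: mat_induct)
    case zero
    then show ?case using \<open>\<psi> (\<lambda>i r c. 0) \<in> J\<close> span_zero by (intro bexI[of _ 0]) auto
  next
    case (add f g)
    then obtain f' g' where fg: "f' \<in> ?S" "g' \<in> ?S" "\<psi> f - f' \<in> J" "\<psi> g - g' \<in> J" by blast
    have "(\<psi> (\<lambda>i r c. f i r c + g i r c) - (\<psi> f + \<psi> g)) + ((\<psi> f - f') + (\<psi> g - g')) \<in> J"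
      using assms(2)[rule_format, OF add(1,2)] fg J by (intro subspace_add) simp_all
    then have "\<psi> (\<lambda>i r c. f i r c + g i r c) - (f' + g') \<in> J" by (simp add: algebra_simps)
    then show ?case using fg span_add by blast
  next
    case (scale a f)
    then obtain f' where f: "f' \<in> ?S" "\<psi> f - f' \<in> J" by blast
    have "(\<psi> (\<lambda>i r c. a * f i r c) - a *s \<psi> f) + a *s (\<psi> f - f') \<in> J"
      using smul[OF scale(1), of a] f J by (intro subspace_add subspace_scale) simp_all
    then have "\<psi> (\<lambda>i r c. a * f i r c) - a *s f' \<in> J" by (simp add: scale_right_diff_distrib)
    then show ?case using f span_scale by blast
  next
    case (unit i r s)
    then have "\<psi> (mat_unit i r s) \<in> ?S" by (intro span_base) (auto simp: unit_set_def)
    then show ?case using subspace_0[OF J] by (intro bexI[of _ "\<psi> (mat_unit i r s)"]) auto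
  qed
qed

end

section \<open>The span of standard matrix units as an image of concrete matrices\<close>

locale standard_units = type_algebra scale + matrix_units "{..<length ns}" "\<lambda>i. {..<ns ! i}" E
  for scale :: "'k::field \<Rightarrow> 'b::ring \<Rightarrow> 'b" (infixr \<open>*s\<close> 75)
    and ns :: "nat list" and E :: "nat \<Rightarrow> nat \<Rightarrow> nat \<Rightarrow> 'b"
begin

sublocale unit_algebra scale "{..<length ns}" "\<lambda>i. {..<ns ! i}" E ..

definition of_mat :: "(nat \<Rightarrow> nat \<Rightarrow> nat \<Rightarrow> 'k) \<Rightarrow> 'b" where
  "of_mat m = (\<Sum>i<length ns. \<Sum>r<ns ! i. \<Sum>s<ns ! i. m i r s *s E i r s)"

lemma of_mat_zero: "of_mat (\<lambda>i r c. 0) = 0"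
  by (simp add: of_mat_def)

lemma of_mat_add: "of_mat (\<lambda>i r c. f i r c + g i r c) = of_mat f + of_mat g"
  by (simp add: of_mat_def scale_left_distrib sum.distrib)

lemma of_mat_scale: "of_mat (\<lambda>i r c. a * f i r c) = a *s of_mat f"
  by (simp add: of_mat_def scale_sum_right)

lemma of_mat_unit:
  assumes "i < length ns" "r < ns ! i" "s < ns ! i"
  shows "of_mat (mat_unit i r s) = E i r s"
proof -
  have "of_mat (mat_unit i r s) = (\<Sum>i'<length ns. if i' = i then E i r s else 0)"
    unfolding of_mat_def
  proof (rule sum.cong)
    fix i' assume "i' \<in> {..<length ns}"
    have "(\<Sum>r'<ns ! i'. \<Sum>s'<ns ! i'. mat_unit i r s i' r' s' *s E i' r' s') =
        (\<Sum>r'<ns ! i'. \<Sum>s'<ns ! i'. if s' = s then (if r' = r then (if i' = i then E i r s else 0) else 0) else 0)"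
      by (intro sum.cong) (auto simp: mat_unit_def)
    then show "(\<Sum>r'<ns ! i'. \<Sum>s'<ns ! i'. mat_unit i r s i' r' s' *s E i' r' s') =
        (if i' = i then E i r s else 0)"
      using assms by (cases "i' = i") (auto intro!: sum.neutral)
  qed simp
  then show ?thesis using assms by simp
qed

text \<open>Both sides are bilinear, so nested inductions over \<open>f\<close> and \<open>g\<close>
  reduce the claim to the multiplication table of the units.\<close>

lemma of_mat_mul:
  assumes f: "f \<in> mat_carrier ns" and g: "g \<in> mat_carrier ns"
  shows "of_mat (amul (matricial_alg ns) f g) = of_mat f * of_mat g"
  using f
proof (induction rule: mat_induct)
  case zero
  have "amul (matricial_alg ns) (\<lambda>i r c. 0) g = (\<lambda>i r c. 0)" by (intro ext) simp
  then show ?case by (simp only: of_mat_zero mult_zero_left)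
next
  case (add f f')
  have "amul (matricial_alg ns) (\<lambda>i r c. f i r c + f' i r c) g =
      (\<lambda>i r c. amul (matricial_alg ns) f g i r c + amul (matricial_alg ns) f' g i r c)"
    by (intro ext) (simp add: distrib_right sum.distrib)
  then show ?case using add.IH by (simp only: of_mat_add distrib_right)
next
  case (scale a f)
  have "amul (matricial_alg ns) (\<lambda>i r c. a * f i r c) g = (\<lambda>i r c. a * amul (matricial_alg ns) f g i r c)"
    by (intro ext) (simp add: mult.assoc sum_distrib_left)
  then show ?case using scale.IH by (simp only: of_mat_scale scale_mult_left)
next
  case (unit i r s)
  show ?case using g
  proof (induction rule: mat_induct)
    case zero
    have "amul (matricial_alg ns) (mat_unit i r s) (\<lambda>i r c. 0) = (\<lambda>i r c. 0 :: 'k)" by (intro ext) simp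
    then show ?case by (simp only: of_mat_zero mult_zero_right)
  next
    case (add g g')
    have "amul (matricial_alg ns) (mat_unit i r s) (\<lambda>i r c. g i r c + g' i r c) =
      (\<lambda>i' r' c'. amul (matricial_alg ns) (mat_unit i r s) g i' r' c' +
        amul (matricial_alg ns) (mat_unit i r s) g' i' r' c')"
      by (intro ext) (simp add: distrib_left sum.distrib)
    then show ?case using add.IH by (simp only: of_mat_add distrib_left)
  next
    case (scale a g)
    have "amul (matricial_alg ns) (mat_unit i r s) (\<lambda>i r c. a * g i r c) =
        (\<lambda>i' r' c'. a * amul (matricial_alg ns) (mat_unit i r s) g i' r' c')"
      by (intro ext) (simp add: mult.left_commute sum_distrib_left)
    then show ?case using scale.IH by (simp only: of_mat_scale scale_mult_right)
  next
    case (unit j t u)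
    show ?case
      unfolding mat_unit_mult[OF \<open>i < length ns\<close> \<open>s < ns ! i\<close>]
      using unit \<open>i < length ns\<close> \<open>r < ns ! i\<close> \<open>s < ns ! i\<close>
      by (auto simp: of_mat_unit of_mat_zero unit_mult)
  qed
qed

lemma of_mat_entry:
  assumes "f \<in> mat_carrier ns" and irs: "i < length ns" "r < ns ! i" "s < ns ! i"
  shows "E i r r * of_mat f * E i s s = f i r s *s E i r s"
  using assms(1)
proof (induction rule: mat_induct)
  case (unit j t u)
  then show ?case using irs by (simp add: of_mat_unit unit_mult) (auto simp: mat_unit_def unit_mult)
qed (simp_all add: of_mat_zero of_mat_add of_mat_scale distrib_left distrib_right
      scale_left_distrib scale_mult_left scale_mult_right)

lemma of_mat_inj: "inj_on of_mat (mat_carrier ns)"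
proof
  fix f g assume fg: "f \<in> mat_carrier ns" "g \<in> mat_carrier ns" "of_mat f = of_mat g"
  show "f = g"
  proof (intro ext)
    fix i r s
    show "f i r s = g i r s"
    proof (cases "i < length ns \<and> r < ns ! i \<and> s < ns ! i")
      case True
      then have irs: "i < length ns" "r < ns ! i" "s < ns ! i" by auto
      have "E i r s * E i s r \<noteq> 0" using irs unit_nonzero by (simp add: unit_mult)
      then have "E i r s \<noteq> 0" by auto
      moreover have "f i r s *s E i r s = g i r s *s E i r s"
        using of_mat_entry[OF fg(1) irs] unfolding fg(3) of_mat_entry[OF fg(2) irs] by (rule sym)
      ultimately show ?thesis using scale_cancel_right by blast
    next
      case False
      then show ?thesis using fg by (auto simp: mat_carrier_def not_less)
    qed
  qed
qed

lemma of_mat_image: "of_mat ` mat_carrier ns = \<A>"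
proof
  show "of_mat ` mat_carrier ns \<subseteq> \<A>"
    unfolding of_mat_def by (auto intro!: span_sum span_scale unit_in)
  have "subspace (of_mat ` mat_carrier ns)"
    unfolding subspace_def
  proof (intro conjI ballI allI)
    show "0 \<in> of_mat ` mat_carrier ns"
      using of_mat_zero mat_carrier_closed(1) by (metis image_eqI)
    fix x assume "x \<in> of_mat ` mat_carrier ns"
    then obtain f where f: "f \<in> mat_carrier ns" "x = of_mat f" by blast
    have "c *s x = of_mat (\<lambda>i r s. c * f i r s)" for c using f by (simp add: of_mat_scale)
    then show "c *s x \<in> of_mat ` mat_carrier ns" for c
      using mat_carrier_closed(3)[OF f(1)] by (rule image_eqI)
    fix y assume "y \<in> of_mat ` mat_carrier ns"
    then obtain g where g: "g \<in> mat_carrier ns" "y = of_mat g" by blast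
    have "x + y = of_mat (\<lambda>i r c. f i r c + g i r c)" using f g by (simp add: of_mat_add)
    then show "x + y \<in> of_mat ` mat_carrier ns"
      using mat_carrier_closed(2)[OF f(1) g(1)] by (rule image_eqI)
  qed
  moreover have "unit_set {..<length ns} (\<lambda>i. {..<ns ! i}) E \<subseteq> of_mat ` mat_carrier ns"
  proof
    fix x assume "x \<in> unit_set {..<length ns} (\<lambda>i. {..<ns ! i}) E"
    then obtain i r s where "i < length ns" "r < ns ! i" "s < ns ! i" "x = E i r s"
      by (elim unit_setE) auto
    then show "x \<in> of_mat ` mat_carrier ns"
      using of_mat_unit mat_carrier_closed(5) by (metis image_eqI)
  qed
  ultimately show "\<A> \<subseteq> of_mat ` mat_carrier ns" by (intro span_minimal)
qed

end

text \<open>Blocks with an empty index set are dropped, because the sizes of a matricial algebra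
  must be positive; they contribute no units. Enumerating the remaining blocks and their indices
  relabels the same set of units.\<close>

lemma standardize_matrix_units:
  assumes "matrix_units I N E"
  shows "\<exists>(ns :: nat list) E'. (\<forall>n\<in>set ns. n > 0) \<and> matrix_units {..<length ns} (\<lambda>i. {..<ns ! i}) E' \<and>
    unit_set {..<length ns} (\<lambda>i. {..<ns ! i}) E' = unit_set I N E"
proof -
  interpret matrix_units I N E by fact
  obtain ks where ks: "set ks = {i \<in> I. N i \<noteq> {}}" "distinct ks"
    using finite_distinct_list[of "{i \<in> I. N i \<noteq> {}}"] finite_I by auto
  have "\<forall>i\<in>I. \<exists>\<beta>. bij_betw \<beta> {..<card (N i)} (N i)"
    using ex_bij_betw_nat_finite finite_N by (metis atLeast0LessThan)
  then obtain \<beta> where \<beta>: "\<And>i. i \<in> I \<Longrightarrow> bij_betw (\<beta> i) {..<card (N i)} (N i)" by metis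
  define ns where "ns = map (\<lambda>i. card (N i)) ks"
  define E' where "E' k r s = E (ks ! k) (\<beta> (ks ! k) r) (\<beta> (ks ! k) s)" for k r s
  have len: "length ns = length ks" by (simp add: ns_def)
  have nth: "ns ! k = card (N (ks ! k))" if "k < length ks" for k using that by (simp add: ns_def)
  have ks_in: "ks ! k \<in> I" if "k < length ks" for k using that ks nth_mem by blast
  have \<beta>_in: "\<beta> (ks ! k) r \<in> N (ks ! k)" if "k < length ks" "r < ns ! k" for k r
    using bij_betwE[OF \<beta>[OF ks_in[OF that(1)]]] that by (simp add: nth)
  have \<beta>_eq: "\<beta> (ks ! k) r = \<beta> (ks ! k) s \<longleftrightarrow> r = s" if "k < length ks" "r < ns ! k" "s < ns ! k" for k r s
    using bij_betw_imp_inj_on[OF \<beta>[OF ks_in[OF that(1)]]] that by (auto simp: nth inj_on_def)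
  have pos: "\<forall>n\<in>set ns. n > 0"
    using ks(1) finite_N by (auto simp: ns_def card_gt_0_iff)
  moreover have "matrix_units {..<length ns} (\<lambda>i. {..<ns ! i}) E'"
  proof
    show "E' k r r \<noteq> 0" if "k \<in> {..<length ns}" "r \<in> {..<ns ! k}" for k r
      using unit_nonzero[OF ks_in[of k] \<beta>_in[of k r]] that by (simp add: E'_def len)
    fix k r s l t u
    assume A: "k \<in> {..<length ns}" "r \<in> {..<ns ! k}" "s \<in> {..<ns ! k}"
      "l \<in> {..<length ns}" "t \<in> {..<ns ! l}" "u \<in> {..<ns ! l}"
    have "E' k r s * E' l t u = (if ks ! k = ks ! l \<and> \<beta> (ks ! k) s = \<beta> (ks ! l) t
        then E (ks ! k) (\<beta> (ks ! k) r) (\<beta> (ks ! l) u) else 0)"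
      unfolding E'_def using A by (intro unit_mult) (auto simp: len ks_in \<beta>_in)
    also have "ks ! k = ks ! l \<longleftrightarrow> k = l" using A ks(2) by (auto simp: len nth_eq_iff_index_eq)
    finally show "E' k r s * E' l t u = (if k = l \<and> s = t then E' k r u else 0)"
      using A by (auto simp: len \<beta>_eq E'_def)
  qed auto
  moreover have "unit_set {..<length ns} (\<lambda>i. {..<ns ! i}) E' = unit_set I N E"
  proof
    show "unit_set {..<length ns} (\<lambda>i. {..<ns ! i}) E' \<subseteq> unit_set I N E"
      by (auto elim!: unit_setE simp: E'_def len intro!: unit_setI ks_in \<beta>_in)
    show "unit_set I N E \<subseteq> unit_set {..<length ns} (\<lambda>i. {..<ns ! i}) E'"
    proof
      fix x assume "x \<in> unit_set I N E"
      then obtain i r s where x: "i \<in> I" "r \<in> N i" "s \<in> N i" "x = E i r s" by (elim unit_setE)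
      then have "i \<in> set ks" using ks by auto
      then obtain k where k: "k < length ks" "ks ! k = i" by (auto simp: in_set_conv_nth)
      have im: "\<beta> i ` {..<ns ! k} = N i"
        using \<beta>[OF x(1)] k by (simp add: bij_betw_def nth)
      obtain r' s' where "r' < ns ! k" "\<beta> i r' = r" "s' < ns ! k" "\<beta> i s' = s"
        using x(2,3) unfolding im[symmetric] by blast
      then have "x = E' k r' s'" "k < length ns" "r' < ns ! k" "s' < ns ! k"
        using x k by (auto simp: E'_def len)
      then show "x \<in> unit_set {..<length ns} (\<lambda>i. {..<ns ! i}) E'"
        by (simp add: unit_setI)
    qed
  qed
  ultimately show ?thesis by blast
qed

section \<open>Transfer between an algebra and its image in the ring type\<close>

lemma restrict_alg_simps [simp]:
  "acarrier (restrict_alg A S) = S" "azero (restrict_alg A S) = azero A"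
  "aadd (restrict_alg A S) = aadd A" "amul (restrict_alg A S) = amul A"
  "asmul (restrict_alg A S) = asmul A"
  by (simp_all add: restrict_alg_def)

lemma quot_alg_simps [simp]:
  "acarrier (quot_alg A J) = coset A J ` acarrier A" "azero (quot_alg A J) = coset A J (azero A)"
  "aadd (quot_alg A J) C D = coset A J (aadd A (rep C) (rep D))"
  "amul (quot_alg A J) C D = coset A J (amul A (rep C) (rep D))"
  "asmul (quot_alg A J) a C = coset A J (asmul A a (rep C))"
  by (simp_all add: quot_alg_def)

context embedded_algebra
begin

lemmas closed = kalgebra_facts(1-4)[OF alg]

lemma hom_zero: "\<iota> (azero A) = 0"
  using hom_add[OF closed(1) closed(1)] kalgebra_facts(7)[OF alg closed(1)] by simp

lemma subspace_image:
  assumes "S \<subseteq> acarrier A" "azero A \<in> S" "\<And>x y. x \<in> S \<Longrightarrow> y \<in> S \<Longrightarrow> aadd A x y \<in> S"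
    "\<And>a x. x \<in> S \<Longrightarrow> asmul A a x \<in> S"
  shows "subspace (\<iota> ` S)"
  unfolding subspace_def
proof (intro conjI ballI allI)
  show "0 \<in> \<iota> ` S" using assms(2) hom_zero by force
  fix x assume "x \<in> \<iota> ` S"
  then obtain x' where x: "x' \<in> S" "x = \<iota> x'" by blast
  have "c *s x = \<iota> (asmul A c x')" for c using x assms(1) hom_smul by auto
  then show "c *s x \<in> \<iota> ` S" for c using assms(4)[OF x(1)] by (rule image_eqI)
  fix y assume "y \<in> \<iota> ` S"
  then obtain y' where y: "y' \<in> S" "y = \<iota> y'" by blast
  have "x + y = \<iota> (aadd A x' y')" using x y assms(1) by (subst hom_add) auto
  then show "x + y \<in> \<iota> ` S" using assms(3)[OF x(1) y(1)] by (rule image_eqI)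
qed

text \<open>The span stays inside the image of the algebra, so the embedding restricts to a
  bijection from \<open>S\<close> onto it. Its inverse after \<open>of_mat\<close> is the required
  isomorphism.\<close>

lemma matricial_span:
  assumes mu: "matrix_units I N E" and sub: "unit_set I N E \<subseteq> \<iota> ` acarrier A"
  defines "S \<equiv> {x \<in> acarrier A. \<iota> x \<in> span (unit_set I N E)}"
  shows "subalgebra S A" "matricial (restrict_alg A S)"
proof -
  obtain ns :: "nat list" and E' where ns: "\<forall>n\<in>set ns. n > 0" and mu': "matrix_units {..<length ns} (\<lambda>i. {..<ns ! i}) E'"
    and eq: "unit_set {..<length ns} (\<lambda>i. {..<ns ! i}) E' = unit_set I N E"
    using standardize_matrix_units[OF mu] by blast
  interpret U: standard_units scale ns E'
    using mu' type_algebra_axioms by (simp add: standard_units_def)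
  have S: "S = {x \<in> acarrier A. \<iota> x \<in> U.\<A>}" by (simp add: S_def eq)
  show "subalgebra S A"
    unfolding subalgebra_def S
    by (auto simp: closed hom_zero hom_add hom_mul hom_smul span_zero span_add span_scale U.mult_in)
  have "span (unit_set I N E) \<subseteq> \<iota> ` acarrier A"
    by (rule span_minimal[OF sub subspace_image]) (auto simp: closed)
  then have "\<iota> ` S = U.\<A>" by (auto simp: S eq)
  moreover have inj_S: "inj_on \<iota> S" using inj by (rule inj_on_subset) (auto simp: S)
  ultimately have bij: "bij_betw \<iota> S U.\<A>" by (simp add: bij_betw_def)
  define \<phi> where "\<phi> m = inv_into S \<iota> (U.of_mat m)" for m
  have "bij_betw U.of_mat (mat_carrier ns) U.\<A>"
    using U.of_mat_inj U.of_mat_image by (simp add: bij_betw_def)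
  then have bij_\<phi>: "bij_betw \<phi> (mat_carrier ns) S"
    using bij_betw_trans[OF _ bij_betw_inv_into[OF bij]] by (simp add: \<phi>_def[abs_def] comp_def)
  have \<phi>: "\<phi> m \<in> acarrier A" "\<iota> (\<phi> m) = U.of_mat m" if "m \<in> mat_carrier ns" for m
  proof -
    show "\<phi> m \<in> acarrier A" using bij_betwE[OF bij_\<phi>] that by (auto simp: S)
    have "U.of_mat m \<in> U.\<A>" using that U.of_mat_image by blast
    then show "\<iota> (\<phi> m) = U.of_mat m"
      unfolding \<phi>_def using bij_betw_inv_into_right[OF bij] by blast
  qed
  have eqI: "x = y" if "x \<in> acarrier A" "y \<in> acarrier A" "\<iota> x = \<iota> y" for x y
    using inj_onD[OF inj] that by blast
  have "kalg_iso (matricial_alg ns) (restrict_alg A S) \<phi>"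
    unfolding kalg_iso_def
  proof (intro conjI ballI allI)
    show "bij_betw \<phi> (acarrier (matricial_alg ns)) (acarrier (restrict_alg A S))" using bij_\<phi> by simp
    fix f :: "nat \<Rightarrow> nat \<Rightarrow> nat \<Rightarrow> 'k" assume "f \<in> acarrier (matricial_alg ns)"
    then have f: "f \<in> mat_carrier ns" by simp
    show "\<phi> (asmul (matricial_alg ns) a f) = asmul (restrict_alg A S) a (\<phi> f)" for a
      using f by (intro eqI) (simp_all add: \<phi> closed mat_carrier_closed hom_smul U.of_mat_scale)
    fix g :: "nat \<Rightarrow> nat \<Rightarrow> nat \<Rightarrow> 'k" assume "g \<in> acarrier (matricial_alg ns)"
    then have g: "g \<in> mat_carrier ns" by simp
    show "\<phi> (aadd (matricial_alg ns) f g) = aadd (restrict_alg A S) (\<phi> f) (\<phi> g)"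
      using f g by (intro eqI) (simp_all add: \<phi> closed mat_carrier_closed hom_add U.of_mat_add)
    show "\<phi> (amul (matricial_alg ns) f g) = amul (restrict_alg A S) (\<phi> f) (\<phi> g)"
      using f g
      by (intro eqI) (simp_all add: \<phi> closed mat_carrier_closed(4) hom_mul U.of_mat_mul del: matricial_alg_simps(4))
  qed
  then show "matricial (restrict_alg A S)" using ns by (auto simp: matricial_def)
qed

text \<open>An isomorphism onto a subalgebra of the ideal, followed by the embedding, is an exact
  homomorphism: the case \<open>{0}\<close> of \<open>units_modulo\<close>.\<close>

lemma ideal_matrix_units:
  assumes J: "kideal J A" and loc: "locally_matricial (restrict_alg A J)"
    and X: "finite X" "X \<subseteq> \<iota> ` J"
  shows "\<exists>(I::nat set) (N::nat \<Rightarrow> nat set) E. matrix_units I N E \<and> unit_set I N E \<subseteq> \<iota> ` J \<and>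
    X \<subseteq> span (unit_set I N E)"
proof -
  have JA: "J \<subseteq> acarrier A" using J by (simp add: kideal_def)
  obtain F where F: "finite F" "F \<subseteq> J" "X = \<iota> ` F"
    using X finite_subset_image by metis
  then obtain S where S: "subalgebra S (restrict_alg A J)" "F \<subseteq> S"
      "matricial (restrict_alg (restrict_alg A J) S)"
    using loc unfolding locally_matricial_def by (metis restrict_alg_simps(1))
  have SJ: "S \<subseteq> J" using S(1) by (simp add: subalgebra_def)
  obtain ns \<phi> where iso: "kalg_iso (matricial_alg ns) (restrict_alg (restrict_alg A J) S) \<phi>"
    using S(3) by (auto simp: matricial_def)
  have bij: "bij_betw \<phi> (mat_carrier ns) S" using iso by (simp add: kalg_iso_def)
  have \<phi>S: "\<phi> f \<in> S" if "f \<in> mat_carrier ns" for f using bij_betwE[OF bij] that by blast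
  have \<phi>A: "\<phi> f \<in> acarrier A" if "f \<in> mat_carrier ns" for f using \<phi>S[OF that] SJ JA by blast
  have \<phi>: "\<phi> (aadd (matricial_alg ns) f g) = aadd A (\<phi> f) (\<phi> g)"
    "\<phi> (amul (matricial_alg ns) f g) = amul A (\<phi> f) (\<phi> g)"
    "\<phi> (asmul (matricial_alg ns) a f) = asmul A a (\<phi> f)"
    if "f \<in> mat_carrier ns" "g \<in> mat_carrier ns" for f g a
    using iso that unfolding kalg_iso_def by (metis matricial_alg_simps(1) restrict_alg_simps)+
  let ?\<psi> = "\<lambda>f. \<iota> (\<phi> f)"
  have \<psi>0: "?\<psi> (\<lambda>i r c. 0) = 0"
    using \<phi>(3)[OF mat_carrier_closed(1) mat_carrier_closed(1), of 0] hom_smul[OF \<phi>A[OF mat_carrier_closed(1)], of 0]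
    by simp
  have inj': "f = (\<lambda>i r c. 0)" if "f \<in> mat_carrier ns" "?\<psi> f \<in> {0}" for f
  proof -
    have "?\<psi> f = ?\<psi> (\<lambda>i r c. 0)" using that \<psi>0 by simp
    then have "\<phi> f = \<phi> (\<lambda>i r c. 0)"
      by (rule inj_onD[OF inj]) (use \<phi>A that mat_carrier_closed(1) in auto)
    then show ?thesis
      using inj_onD[OF bij_betw_imp_inj_on[OF bij]] that mat_carrier_closed(1) by blast
  qed
  have add': "?\<psi> (aadd (matricial_alg ns) f g) - (?\<psi> f + ?\<psi> g) \<in> {0}"
    and mul': "?\<psi> (amul (matricial_alg ns) f g) - ?\<psi> f * ?\<psi> g \<in> {0}"
    if "f \<in> mat_carrier ns" "g \<in> mat_carrier ns" for f g
    unfolding \<phi>[OF that] using that by (simp_all add: hom_add hom_mul \<phi>A)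
  have smul': "?\<psi> (asmul (matricial_alg ns) a f) - a *s ?\<psi> f \<in> {0}" if "f \<in> mat_carrier ns" for a f
    unfolding \<phi>(3)[OF that that] using that by (simp add: hom_smul \<phi>A)
  have hom1: "\<forall>f\<in>mat_carrier ns. \<forall>g\<in>mat_carrier ns.
      ?\<psi> (aadd (matricial_alg ns) f g) - (?\<psi> f + ?\<psi> g) \<in> {0}" by (intro ballI add')
  have hom2: "\<forall>f\<in>mat_carrier ns. \<forall>g\<in>mat_carrier ns.
      ?\<psi> (amul (matricial_alg ns) f g) - ?\<psi> f * ?\<psi> g \<in> {0}" by (intro ballI mul')
  have hom3: "\<forall>a. \<forall>f\<in>mat_carrier ns.
      ?\<psi> (asmul (matricial_alg ns) a f) - a *s ?\<psi> f \<in> {0}" by (intro allI ballI smul')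
  have hom4: "\<forall>f\<in>mat_carrier ns. ?\<psi> f \<in> {0} \<longrightarrow> f = (\<lambda>i r c. 0)" by (intro ballI impI inj')
  note units = units_modulo[OF subspace_single_0 hom1 hom2 hom3 hom4]
  let ?E = "\<lambda>i r s. ?\<psi> (mat_unit i r s)"
  have "matrix_units {..<length ns} (\<lambda>i. {..<ns ! i}) ?E"
  proof
    show "?E i r r \<noteq> 0" if "i \<in> {..<length ns}" "r \<in> {..<ns ! i}" for i r
      using units(1) that by auto
    show "?E i r s * ?E j t u = (if i = j \<and> s = t then ?E i r u else 0)"
      if "i \<in> {..<length ns}" "r \<in> {..<ns ! i}" "s \<in> {..<ns ! i}"
        "j \<in> {..<length ns}" "t \<in> {..<ns ! j}" "u \<in> {..<ns ! j}" for i r s j t u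
    proof -
      have "?E i r s * ?E j t u - (if i = j \<and> s = t then ?E i r u else 0) \<in> {0}"
        using that by (intro units(2)) auto
      then show ?thesis by simp
    qed
  qed auto
  moreover have "unit_set {..<length ns} (\<lambda>i. {..<ns ! i}) ?E \<subseteq> \<iota> ` J"
  proof
    fix y assume "y \<in> unit_set {..<length ns} (\<lambda>i. {..<ns ! i}) ?E"
    then obtain i r s where irs: "i < length ns" "r < ns ! i" "s < ns ! i" and y: "y = ?E i r s"
      by (elim unit_setE) simp
    show "y \<in> \<iota> ` J" using \<phi>S[OF mat_carrier_closed(5)[OF irs]] SJ y by blast
  qed
  moreover have "X \<subseteq> span (unit_set {..<length ns} (\<lambda>i. {..<ns ! i}) ?E)"
  proof
    fix x assume "x \<in> X"
    then obtain f where "f \<in> F" "x = \<iota> f" using F by blast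
    then obtain m where m: "m \<in> mat_carrier ns" "x = ?\<psi> m"
      using S(2) bij_betw_imp_surj_on[OF bij] by blast
    then show "x \<in> span (unit_set {..<length ns} (\<lambda>i. {..<ns ! i}) ?E)" using units(3)[OF m(1)] by auto
  qed
  ultimately show ?thesis by blast
qed

text \<open>\<open>rep\<close> picks arbitrary elements of cosets, so an isomorphism into the
  quotient followed by \<open>rep\<close> and the embedding respects the operations only modulo the
  image of \<open>J\<close>. Its values lie in that image exactly on the zero coset, which keeps the
  diagonal representatives outside.\<close>

lemma quotient_matrix_units:
  assumes J: "kideal J A" and loc: "locally_matricial (quot_alg A J)"
    and F: "finite F" "F \<subseteq> acarrier A"
  shows "\<exists>(ns :: nat list) x. (\<forall>n\<in>set ns. n > 0) \<and>
    (\<forall>i<length ns. \<forall>r<ns ! i. \<forall>s<ns ! i. x i r s \<in> \<iota> ` acarrier A) \<and>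
    (\<forall>i<length ns. \<forall>r<ns ! i. x i r r \<notin> \<iota> ` J) \<and>
    (\<forall>i<length ns. \<forall>r<ns ! i. \<forall>s<ns ! i. \<forall>j<length ns. \<forall>t<ns ! j. \<forall>u<ns ! j.
       x i r s * x j t u - (if i = j \<and> s = t then x i r u else 0) \<in> \<iota> ` J) \<and>
    (\<forall>f\<in>F. \<exists>g\<in>span (unit_set {..<length ns} (\<lambda>i. {..<ns ! i}) x). \<iota> f - g \<in> \<iota> ` J)"
proof -
  have JA: "J \<subseteq> acarrier A" and J0: "azero A \<in> J" using J by (simp_all add: kideal_def)
  have subJ: "subspace (\<iota> ` J)" using J by (intro subspace_image) (auto simp: kideal_def)
  have rep_in: "\<exists>j\<in>J. rep (coset A J x) = aadd A x j" for x
  proof -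
    have "rep (coset A J x) \<in> coset A J x"
      unfolding rep_def by (rule someI[of _ "aadd A x (azero A)"]) (use J0 in \<open>auto simp: coset_def\<close>)
    then show ?thesis by (auto simp: coset_def)
  qed
  have rep_A: "rep (coset A J x) \<in> acarrier A"
    and rep_cong: "\<iota> (rep (coset A J x)) - \<iota> x \<in> \<iota> ` J" if x: "x \<in> acarrier A" for x
  proof -
    obtain j where j: "j \<in> J" "rep (coset A J x) = aadd A x j" using rep_in by blast
    then show "rep (coset A J x) \<in> acarrier A" using x JA closed by auto
    have "\<iota> (rep (coset A J x)) - \<iota> x = \<iota> j" using j x JA hom_add by auto
    then show "\<iota> (rep (coset A J x)) - \<iota> x \<in> \<iota> ` J" using j by simp
  qed
  have coset_subset: "coset A J x \<subseteq> coset A J y"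
    if x: "x \<in> acarrier A" and y: "y \<in> acarrier A" and xy: "\<iota> x - \<iota> y \<in> \<iota> ` J" for x y
  proof
    fix z assume "z \<in> coset A J x"
    then obtain j where j: "j \<in> J" "z = aadd A x j" by (auto simp: coset_def)
    obtain k where k: "k \<in> J" "\<iota> x - \<iota> y = \<iota> k" using xy by blast
    have kA: "k \<in> acarrier A" "j \<in> acarrier A" using j k JA by auto
    have "\<iota> x = \<iota> (aadd A y k)" using k kA y by (simp add: hom_add diff_eq_eq add.commute)
    then have "x = aadd A y k" using inj_onD[OF inj] x y kA closed by blast
    then have "z = aadd A y (aadd A k j)" using j y kA kalgebra_facts(5)[OF alg] by simp
    moreover have "aadd A k j \<in> J" using J j k by (simp add: kideal_def)
    ultimately show "z \<in> coset A J y" by (auto simp: coset_def)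
  qed
  have coset_eq: "coset A J x = coset A J y"
    if "x \<in> acarrier A" "y \<in> acarrier A" "\<iota> x - \<iota> y \<in> \<iota> ` J" for x y
    using coset_subset[of x y] coset_subset[of y x] subspace_neg[OF subJ that(3)] that by auto

  have "finite (coset A J ` F)" "coset A J ` F \<subseteq> acarrier (quot_alg A J)" using F by auto
  then obtain S where S: "subalgebra S (quot_alg A J)" "coset A J ` F \<subseteq> S"
      "matricial (restrict_alg (quot_alg A J) S)"
    using loc unfolding locally_matricial_def by metis
  obtain ns \<phi> where ns: "\<forall>n\<in>set ns. n > 0"
    and iso: "kalg_iso (matricial_alg ns) (restrict_alg (quot_alg A J) S) \<phi>"
    using S(3) by (auto simp: matricial_def)
  have bij: "bij_betw \<phi> (mat_carrier ns) S" using iso by (simp add: kalg_iso_def)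
  have SA: "S \<subseteq> coset A J ` acarrier A" using S(1) by (simp add: subalgebra_def)
  have \<phi>A: "rep (\<phi> f) \<in> acarrier A" and \<phi>_coset: "\<phi> f = coset A J (rep (\<phi> f))"
    if f: "f \<in> mat_carrier ns" for f
  proof -
    obtain x where x: "x \<in> acarrier A" "\<phi> f = coset A J x" using bij_betwE[OF bij] f SA by blast
    then show "rep (\<phi> f) \<in> acarrier A" using rep_A by simp
    then show "\<phi> f = coset A J (rep (\<phi> f))" using x coset_eq[OF _ x(1)] rep_cong[OF x(1)] by simp
  qed
  have \<phi>: "\<phi> (aadd (matricial_alg ns) f g) = coset A J (aadd A (rep (\<phi> f)) (rep (\<phi> g)))"
    "\<phi> (amul (matricial_alg ns) f g) = coset A J (amul A (rep (\<phi> f)) (rep (\<phi> g)))"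
    "\<phi> (asmul (matricial_alg ns) a f) = coset A J (asmul A a (rep (\<phi> f)))"
    if "f \<in> mat_carrier ns" "g \<in> mat_carrier ns" for f g a
    using iso that unfolding kalg_iso_def
    by (metis matricial_alg_simps(1) restrict_alg_simps(1,3-5) quot_alg_simps(3-5))+
  let ?\<psi> = "\<lambda>f. \<iota> (rep (\<phi> f))"
  have \<psi>0: "\<phi> (\<lambda>i r c. 0) = coset A J (azero A)"
    using \<phi>(3)[OF mat_carrier_closed(1) mat_carrier_closed(1), of 0]
      kalgebra_zero(1)[OF alg \<phi>A[OF mat_carrier_closed(1)]] by simp
  have inj': "f = (\<lambda>i r c. 0)" if f: "f \<in> mat_carrier ns" and "?\<psi> f \<in> \<iota> ` J" for f
  proof -
    have "\<phi> f = \<phi> (\<lambda>i r c. 0)"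
      using \<phi>_coset[OF f] coset_eq[OF \<phi>A[OF f] closed(1)] that \<psi>0 hom_zero by simp
    then show ?thesis
      using inj_onD[OF bij_betw_imp_inj_on[OF bij]] that mat_carrier_closed(1) by blast
  qed
  have add': "?\<psi> (aadd (matricial_alg ns) f g) - (?\<psi> f + ?\<psi> g) \<in> \<iota> ` J"
    and mul': "?\<psi> (amul (matricial_alg ns) f g) - ?\<psi> f * ?\<psi> g \<in> \<iota> ` J"
    if fg: "f \<in> mat_carrier ns" "g \<in> mat_carrier ns" for f g
    unfolding \<phi>[OF fg] hom_add[OF \<phi>A[OF fg(1)] \<phi>A[OF fg(2)], symmetric]
      hom_mul[OF \<phi>A[OF fg(1)] \<phi>A[OF fg(2)], symmetric]
    by (intro rep_cong closed \<phi>A fg)+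
  have smul': "?\<psi> (asmul (matricial_alg ns) a f) - a *s ?\<psi> f \<in> \<iota> ` J" if f: "f \<in> mat_carrier ns" for a f
    unfolding \<phi>(3)[OF f f] hom_smul[OF \<phi>A[OF f], symmetric]
    by (intro rep_cong closed \<phi>A f)
  have hom1: "\<forall>f\<in>mat_carrier ns. \<forall>g\<in>mat_carrier ns.
      ?\<psi> (aadd (matricial_alg ns) f g) - (?\<psi> f + ?\<psi> g) \<in> \<iota> ` J" by (intro ballI add')
  have hom2: "\<forall>f\<in>mat_carrier ns. \<forall>g\<in>mat_carrier ns.
      ?\<psi> (amul (matricial_alg ns) f g) - ?\<psi> f * ?\<psi> g \<in> \<iota> ` J" by (intro ballI mul')
  have hom3: "\<forall>a. \<forall>f\<in>mat_carrier ns.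
      ?\<psi> (asmul (matricial_alg ns) a f) - a *s ?\<psi> f \<in> \<iota> ` J" by (intro allI ballI smul')
  have hom4: "\<forall>f\<in>mat_carrier ns. ?\<psi> f \<in> \<iota> ` J \<longrightarrow> f = (\<lambda>i r c. 0)" by (intro ballI impI inj')
  note units = units_modulo[OF subJ hom1 hom2 hom3 hom4]
  let ?x = "\<lambda>i r s. ?\<psi> (mat_unit i r s)"
  have xA: "?x i r s \<in> \<iota> ` acarrier A" if "i < length ns" "r < ns ! i" "s < ns ! i" for i r s
    using \<phi>A[OF mat_carrier_closed(5)[OF that]] by simp
  have xF: "\<exists>g\<in>span (unit_set {..<length ns} (\<lambda>i. {..<ns ! i}) ?x). \<iota> f - g \<in> \<iota> ` J"
    if f: "f \<in> F" for f
  proof -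
    have fA: "f \<in> acarrier A" using f F by blast
    obtain m where m: "m \<in> mat_carrier ns" "coset A J f = \<phi> m"
      using f S(2) bij_betw_imp_surj_on[OF bij] by blast
    obtain g where g: "g \<in> span (unit_set {..<length ns} (\<lambda>i. {..<ns ! i}) ?x)" "?\<psi> m - g \<in> \<iota> ` J"
      using units(3)[OF m(1)] by blast
    have "?\<psi> m - \<iota> f \<in> \<iota> ` J" using rep_cong[OF fA] m by simp
    then have "(?\<psi> m - g) - (?\<psi> m - \<iota> f) \<in> \<iota> ` J" using g subspace_diff[OF subJ] by blast
    then show ?thesis using g by (intro bexI[of _ g]) auto
  qed
  show ?thesis
    by (intro exI[of _ ns] exI[of _ ?x] conjI ns allI impI ballI xA xF units(1,2))
qed

end

section \<open>Assembly: embedding, extension of matrix units, pullback to the algebra\<close>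

theorem theorem3p4:
  fixes R :: "('k::field, 'a) kalg" and J :: "'a set"
  assumes "kalgebra R"
    and "kideal J R"
    and "locally_matricial (restrict_alg R J)"
    and "locally_matricial (quot_alg R J)"
  shows "locally_matricial R"
  unfolding locally_matricial_def
proof (intro allI impI, elim conjE)
  fix F assume F: "finite F" "F \<subseteq> acarrier R"
  obtain \<iota> where "embedded_algebra (big_scale :: 'k \<Rightarrow> ('k, 'a) big_algebra \<Rightarrow> _) R \<iota>"
    using embedding_exists[OF assms(1)] by blast
  then interpret embedded_algebra "big_scale :: 'k \<Rightarrow> ('k, 'a) big_algebra \<Rightarrow> _" R \<iota> .
  note J = assms(2)[unfolded kideal_def]
  obtain ns :: "nat list" and x where ns: "\<forall>n\<in>set ns. n > 0"
    and xR: "\<forall>i<length ns. \<forall>r<ns ! i. \<forall>s<ns ! i. x i r s \<in> \<iota> ` acarrier R"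
    and x_nonzero: "\<forall>i<length ns. \<forall>r<ns ! i. x i r r \<notin> \<iota> ` J"
    and x_mult: "\<forall>i<length ns. \<forall>r<ns ! i. \<forall>s<ns ! i. \<forall>j<length ns. \<forall>t<ns ! j. \<forall>u<ns ! j.
       x i r s * x j t u - (if i = j \<and> s = t then x i r u else 0) \<in> \<iota> ` J"
    and Fx: "\<forall>f\<in>F. \<exists>g\<in>big.span (unit_set {..<length ns} (\<lambda>i. {..<ns ! i}) x). \<iota> f - g \<in> \<iota> ` J"
    using quotient_matrix_units[OF assms(2,4) F] by (elim exE conjE) (erule (4) that)
  have mulR: "y * z \<in> \<iota> ` acarrier R" if "y \<in> \<iota> ` acarrier R" "z \<in> \<iota> ` acarrier R" for y z
    using that closed by (auto simp: hom_mul[symmetric])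
  have mulJ: "y * z \<in> \<iota> ` J" "z * y \<in> \<iota> ` J" if y: "y \<in> \<iota> ` acarrier R" and z: "z \<in> \<iota> ` J" for y z
  proof -
    obtain y' where y': "y = \<iota> y'" "y' \<in> acarrier R" using y by blast
    obtain z' where z': "z = \<iota> z'" "z' \<in> J" using z by blast
    have "z' \<in> acarrier R" using z' J by blast
    with y' z' show "y * z \<in> \<iota> ` J" "z * y \<in> \<iota> ` J" using J by (auto simp: hom_mul[symmetric])
  qed
  \<comment> \<open>The left copy of \<open>nat\<close> numbers the blocks lifted from the quotient,
    the right copy those found inside the ideal.\<close>
  have "\<exists>(I::(nat + nat) set) (N::nat + nat \<Rightarrow> nat set) E.
    matrix_units I N E \<and> unit_set I N E \<subseteq> \<iota> ` acarrier R \<and> \<iota> ` F \<subseteq> big.span (unit_set I N E)"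
  proof (rule big.extension_matrix_units[where J = "\<iota> ` J" and I = "{..<length ns}" and
        N = "\<lambda>i. {..<ns ! i}" and x = x])
    show "big.subspace (\<iota> ` acarrier R)" by (rule subspace_image) (auto simp: closed)
    show "big.subspace (\<iota> ` J)" using J by (intro subspace_image) auto
    show "\<iota> ` J \<subseteq> \<iota> ` acarrier R" using J by blast
    show "\<exists>(I::nat set) (N::nat \<Rightarrow> nat set) E. matrix_units I N E \<and> unit_set I N E \<subseteq> \<iota> ` J \<and>
      X \<subseteq> big.span (unit_set I N E)" if "finite X" "X \<subseteq> \<iota> ` J" for X
      using ideal_matrix_units[OF assms(2,3) that] .
    show "finite (\<iota> ` F)" "\<iota> ` F \<subseteq> \<iota> ` acarrier R" using F by auto
    show "finite {..<length ns}" by simp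
    show "finite {..<ns ! i}" for i by simp
    show "{..<ns ! i} \<noteq> {}" if "i \<in> {..<length ns}" for i
      using ns that by (auto simp: lessThan_empty_iff)
    show "x i r s \<in> \<iota> ` acarrier R" if "i \<in> {..<length ns}" "r \<in> {..<ns ! i}" "s \<in> {..<ns ! i}" for i r s
      using xR that by simp
    show "x i r r \<notin> \<iota> ` J" if "i \<in> {..<length ns}" "r \<in> {..<ns ! i}" for i r
      using x_nonzero that by simp
    show "x i r s * x j t u - (if i = j \<and> s = t then x i r u else 0) \<in> \<iota> ` J"
      if "i \<in> {..<length ns}" "r \<in> {..<ns ! i}" "s \<in> {..<ns ! i}"
        "j \<in> {..<length ns}" "t \<in> {..<ns ! j}" "u \<in> {..<ns ! j}" for i r s j t u
      using x_mult that by blast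
    show "\<exists>g\<in>big.span (unit_set {..<length ns} (\<lambda>i. {..<ns ! i}) x). f - g \<in> \<iota> ` J"
      if "f \<in> \<iota> ` F" for f using Fx that by blast
  qed (use mulR mulJ in auto)
  then obtain I :: "(nat + nat) set" and N :: "nat + nat \<Rightarrow> nat set" and E
    where E: "matrix_units I N E" "unit_set I N E \<subseteq> \<iota> ` acarrier R"
      "\<iota> ` F \<subseteq> big.span (unit_set I N E)"
    by blast
  let ?S = "{y \<in> acarrier R. \<iota> y \<in> big.span (unit_set I N E)}"
  have "F \<subseteq> ?S" using F(2) E(3) by blast
  then show "\<exists>S. subalgebra S R \<and> F \<subseteq> S \<and> matricial (restrict_alg R S)"
    using matricial_span[OF E(1,2)] by blast
qed

end
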